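(* The following are true. (i) For every pair of non-negative integers $n$ and $m$, $$MO(3m+2;3n+1)\equiv MO(3m+2;3n+2)\equiv 0\pmod 3.$$ (ii) For every pair of non-negative integers $n$ and $m$, $$MO(11m+10; 11n+7)\equiv 0\pmod{11}.$$ (iii) For every pair of non-negative integers $n$ and $m$, $$MO(17m+16; 17n+15)\equiv 0\pmod{17}.$$
   Context: For a positive integer $a$, the integers $MO(a;n)$ are the coefficients of the formal power series $$\sum_{n\geq0}MO(a;n)\,q^n:=\sum_{0< k_1<k_2<\cdots<k_a} \frac{q^{k_1+k_2+\cdots+k_a}}{(1-q^{k_1})^2(1-q^{k_2})^2\cdots(1-q^{k_a})^2}.$$ *)

theory Defs
  imports
    "HOL-Analysis.Infinite_Sum"
    "HOL-Number_Theory.Cong"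
begin

definition increasing_tuples :: "nat \<Rightarrow> nat list set" where
  "increasing_tuples a =
     {ks. length ks = a \<and> (\<forall>k\<in>set ks. 0 < k) \<and> sorted_wrt (<) ks}"

definition MO_denom :: "nat list \<Rightarrow> int fps" where
  "MO_denom ks = (\<Prod>k\<leftarrow>ks. (1 - fps_X ^ k)\<^sup>2)"

text \<open>
  The operation \<open>/\<close> on formal power series needs an inverse on the coefficients and is therefore
  not available over the integers. A series over a ring with constant coefficient 1 is inverted by
  \<open>fps_right_inverse\<close>; its second argument is the inverse of the constant coefficient.
\<close>
definition MO_term :: "nat list \<Rightarrow> int fps" where
  "MO_term ks = fps_X ^ sum_list ks * fps_right_inverse (MO_denom ks) 1"

text \<open>The infinite sum is taken in the usual (\<open>X\<close>-adic) topology of the ring of power series.\<close>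
definition MO :: "nat \<Rightarrow> nat \<Rightarrow> int" where
  "MO a n = fps_nth (\<Sum>\<^sub>\<infinity>ks\<in>increasing_tuples a. MO_term ks) n"

text \<open>
  The denominators are indeed invertible and the series does converge, so no default value of
  \<open>fps_right_inverse\<close> or \<open>infsum\<close> is used.
\<close>
lemma MO_denom_inverse:
  assumes "ks \<in> increasing_tuples a"
  shows "MO_denom ks * fps_right_inverse (MO_denom ks) 1 = 1"
proof (rule fps_right_inverse)
  have "\<forall>k\<in>set ks. 0 < k"
    using assms by (simp add: increasing_tuples_def)
  hence "fps_nth (MO_denom ks) 0 = 1"
    unfolding MO_denom_def by (induction ks) (auto simp: power2_eq_square)
  thus "fps_nth (MO_denom ks) 0 * 1 = 1"
    by simp
qed

lemma MO_term_summable: "MO_term summable_on increasing_tuples a"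
proof -
  have fin: "finite {ks \<in> increasing_tuples a. fps_nth (MO_term ks) n \<noteq> 0}" for n
  proof (rule finite_subset)
    show "{ks \<in> increasing_tuples a. fps_nth (MO_term ks) n \<noteq> 0}
            \<subseteq> {ks. set ks \<subseteq> {..n} \<and> length ks = a}"
    proof
      fix ks
      assume ks: "ks \<in> {ks \<in> increasing_tuples a. fps_nth (MO_term ks) n \<noteq> 0}"
      hence "sum_list ks \<le> n"
        by (auto simp: MO_term_def fps_X_power_mult_nth split: if_splits)
      thus "ks \<in> {ks. set ks \<subseteq> {..n} \<and> length ks = a}"
        using ks member_le_sum_list[of _ ks] by (fastforce simp: increasing_tuples_def)
    qed
    show "finite {ks. set ks \<subseteq> {..n} \<and> length ks = a}"
      by (rule finite_lists_length_eq) simp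
  qed
  define S where "S = Abs_fps (\<lambda>n.
    \<Sum>ks | ks \<in> increasing_tuples a \<and> fps_nth (MO_term ks) n \<noteq> 0. fps_nth (MO_term ks) n)"
  have "(MO_term has_sum S) (increasing_tuples a)"
    by (rule has_sum_fpsI) (use fin in \<open>simp_all add: S_def\<close>)
  thus ?thesis
    by (auto simp: summable_on_def)
qed

end

theory Submission
  imports Defs "HOL-Library.Nat_Bijection" "HOL-Number_Theory.Residues"
begin

text \<open>
  Write \<open>\<theta> = q d/dq\<close>, \<open>E = \<Prod> (1 - q\<^sup>k)\<close> and \<open>M\<^sub>a = \<Sum> MO(a; n) q\<^sup>n\<close>. As
  \<open>\<Sum> M\<^sub>a x\<^sup>a = \<Prod> (1 + x q\<^sup>k / (1 - q\<^sup>k)\<^sup>2)\<close>, the Jacobi triple product at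
  \<open>2 - x = \<zeta> + \<zeta>\<^sup>-\<^sup>1\<close> expresses \<open>B\<^sub>a = E\<^sup>3 M\<^sub>a\<close> through triangular numbers, and its heat equation reads
  \<open>(2 a + 2) (2 a + 3) B\<^bsub>a+1\<^esub> = (a (a + 1) - 2 \<theta>) B\<^sub>a\<close>. Hence for \<open>a \<equiv> -1\<close> modulo \<open>p\<close> the series
  \<open>B\<^sub>a\<close> is supported on multiples of \<open>p\<close> modulo \<open>p\<close>. So is every \<open>p\<close>-th power, and for \<open>p = 3\<close>
  the factor \<open>E\<^bsup>-3\<^esup>\<close> is such a power, which gives (i).

  For \<open>p = 11\<close> and \<open>p = 17\<close> the factor \<open>E\<^bsup>-3\<^esup>\<close> is a \<open>p\<close>-th power times \<open>E\<^bsup>96\<^esup>\<close> respectively \<open>E\<^bsup>48\<^esup>\<close>, so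
  with \<open>\<Delta> = q E\<^bsup>24\<^esup>\<close> it remains to see that the coefficients of \<open>\<Delta>\<^sup>4\<close> respectively \<open>\<Delta>\<^sup>2\<close> at
  multiples of \<open>p\<close> vanish modulo \<open>p\<close>. This holds because these series lie in the image of \<open>\<theta>\<close> modulo
  \<open>p\<close>: by Ramanujan's differential equations for the Eisenstein series \<open>P, Q, R\<close> and
  \<open>1728 \<Delta> = Q\<^sup>3 - R\<^sup>2\<close>, an explicit polynomial in \<open>Q, R\<close> has the required derivative up to a power of
  \<open>Q R\<close> respectively \<open>8 Q\<^sup>4 - 7 Q R\<^sup>2\<close>. The latter are \<open>1\<close> modulo \<open>p\<close>, as follows by evaluating
  \<open>(8 \<theta> + 1)\<^bsup>(p-1)/2\<^esup> E\<^sup>3\<close> in two ways: it is \<open>E\<^sup>3\<close> modulo \<open>p\<close> by Fermat's theorem applied to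
  \<open>E\<^sup>3 = \<Sum> (-1)\<^sup>n (2 n + 1) q\<^bsup>n(n+1)/2\<^esup>\<close>, and \<open>E\<^sup>3\<close> times a polynomial in \<open>P, Q, R\<close> by the
  differential equations.
\<close>

section \<open>Truncated power series and the Euler product\<close>

definition qpoch :: "nat \<Rightarrow> int fps" where
  "qpoch N = (\<Prod>k=1..N. 1 - fps_X ^ k)"

text \<open>The infinite product of all \<open>1 - q^k\<close>, read off diagonally: factors with
  \<open>k > n\<close> do not affect the coefficient of \<open>q^n\<close>.\<close>

definition euler_fps :: "int fps" where
  "euler_fps = Abs_fps (\<lambda>n. fps_nth (qpoch n) n)"

definition MO_fps :: "nat \<Rightarrow> int fps" where
  "MO_fps a = Abs_fps (MO a)"

definition fps_theta :: "int fps \<Rightarrow> int fps" where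
  "fps_theta f = fps_X * fps_deriv f"

text \<open>Congruence modulo \<open>q^m\<close>. Infinite products and sums are compared through
  finite truncations.\<close>

definition trunc_eq :: "nat \<Rightarrow> int fps \<Rightarrow> int fps \<Rightarrow> bool" where
  "trunc_eq m f g \<longleftrightarrow> (\<forall>n<m. fps_nth f n = fps_nth g n)"

lemma fps_theta_nth [simp]: "fps_nth (fps_theta f) n = int n * fps_nth f n"
  by (cases n) (simp_all add: fps_theta_def)

lemma trunc_eq_refl [simp]: "trunc_eq m f f"
  by (simp add: trunc_eq_def)

lemma trunc_eq_sym: "trunc_eq m f g \<Longrightarrow> trunc_eq m g f"
  by (simp add: trunc_eq_def)

lemma trunc_eq_trans [trans]: "trunc_eq m f g \<Longrightarrow> trunc_eq m g h \<Longrightarrow> trunc_eq m f h"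
  by (simp add: trunc_eq_def)

lemma trunc_eq_mono: "trunc_eq m f g \<Longrightarrow> l \<le> m \<Longrightarrow> trunc_eq l f g"
  by (simp add: trunc_eq_def)

lemma trunc_eq_mult: "trunc_eq m f g \<Longrightarrow> trunc_eq m f' g' \<Longrightarrow> trunc_eq m (f * f') (g * g')"
  by (auto simp: trunc_eq_def fps_mult_nth intro!: sum.cong)

lemma trunc_eq_power: "trunc_eq m f g \<Longrightarrow> trunc_eq m (f ^ k) (g ^ k)"
  by (induction k) (auto intro: trunc_eq_mult)

lemma trunc_eq_sum: "(\<And>i. i \<in> A \<Longrightarrow> trunc_eq m (f i) (g i)) \<Longrightarrow> trunc_eq m (sum f A) (sum g A)"
  by (auto simp: trunc_eq_def fps_sum_nth intro!: sum.cong)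

lemma trunc_eq_fps_X_power_mult:
  "trunc_eq m f g \<Longrightarrow> trunc_eq (m + k) (fps_X ^ k * f) (fps_X ^ k * g)"
  by (auto simp: trunc_eq_def fps_X_power_mult_nth)

lemma fps_eq_trunc_eqI: "(\<And>m. trunc_eq m f g) \<Longrightarrow> f = g"
  by (auto simp: fps_eq_iff trunc_eq_def)

lemma qpoch_0 [simp]: "qpoch 0 = 1"
  by (simp add: qpoch_def)

lemma qpoch_Suc [simp]: "qpoch (Suc N) = qpoch N * (1 - fps_X ^ Suc N)"
  by (simp add: qpoch_def)

lemma qpoch_nth_0 [simp]: "fps_nth (qpoch N) 0 = 1"
  by (induction N) auto

lemma qpoch_nonzero [simp]: "qpoch N \<noteq> 0"
  using qpoch_nth_0[of N] by (metis fps_zero_nth zero_neq_one)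

text \<open>Every factor with index above \<open>K\<close> is \<open>1\<close> modulo
  \<open>q^(K+1)\<close>.\<close>

lemma trunc_eq_qpoch: "K \<le> M \<Longrightarrow> trunc_eq (Suc K) (qpoch M) (qpoch K)"
proof (induction M rule: dec_induct)
  case base
  show ?case by simp
next
  case (step M)
  have "trunc_eq (Suc K) (1 - fps_X ^ Suc M) (1 :: int fps)"
    using step.hyps by (auto simp: trunc_eq_def)
  from trunc_eq_mult[OF step.IH this] show ?case by simp
qed

lemma trunc_eq_euler: "trunc_eq (Suc N) euler_fps (qpoch N)"
  unfolding trunc_eq_def euler_fps_def
  using trunc_eq_qpoch by (auto simp: trunc_eq_def less_Suc_eq_le)

lemma euler_fps_nth_0 [simp]: "fps_nth euler_fps 0 = 1"
  by (simp add: euler_fps_def)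

lemma mult_fps_right_inverse_1:
  fixes f :: "int fps"
  assumes "fps_nth f 0 = 1"
  shows "f * fps_right_inverse f 1 = 1"
  by (rule fps_right_inverse) (simp add: assms)

text \<open>Constant coefficient \<open>1\<close> makes \<open>c\<close> a unit over the
  integers.\<close>

lemma trunc_eq_mult_cancel:
  assumes "trunc_eq m (c * f) (c * g)" "fps_nth c 0 = 1"
  shows "trunc_eq m f g"
proof -
  have inv: "fps_right_inverse c 1 * (c * h) = h" for h
    using mult_fps_right_inverse_1[OF assms(2)] by (simp add: mult.assoc[symmetric] mult.commute)
  from trunc_eq_mult[OF trunc_eq_refl[of _ "fps_right_inverse c 1"] assms(1)] show ?thesis
    by (simp only: inv)
qed

section \<open>The finite Jacobi triple product\<close>

text \<open>Gaussian binomial coefficients, introduced by one of the two q-Pascal rules so that no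
  division occurs.\<close>

fun qbinom :: "nat \<Rightarrow> nat \<Rightarrow> int fps" where
  "qbinom n 0 = 1"
| "qbinom 0 (Suc k) = 0"
| "qbinom (Suc n) (Suc k) = fps_X ^ Suc k * qbinom n (Suc k) + qbinom n k"

lemma qbinom_eq_0 [simp]: "n < k \<Longrightarrow> qbinom n k = 0"
  by (induction n k rule: qbinom.induct) auto

lemma qbinom_self [simp]: "qbinom n n = 1"
  by (induction n) auto

text \<open>The quotient formula for Gaussian binomials, cleared of denominators. With
  \<open>n = k + m + 1\<close> the induction rests on
  \<open>q^(k+1) (1 - q^(m+1)) + (1 - q^(k+1)) = 1 - q^(n+1)\<close>.\<close>

lemma qbinom_qpoch:
  "k \<le> n \<Longrightarrow> qbinom n k * (qpoch k * qpoch (n - k)) = qpoch n"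
proof (induction n k rule: qbinom.induct)
  case (3 n k)
  show ?case
  proof (cases "k = n")
    case False
    with 3 have kn: "Suc k \<le> n" by simp
    define m where "m = n - Suc k"
    have n: "n = Suc (k + m)" and nk: "n - k = Suc m"
      using kn by (auto simp: m_def)
    have 1: "qbinom n (Suc k) * (qpoch k * (1 - fps_X ^ Suc k) * qpoch m) = qpoch n"
      using 3(1) kn by (simp add: m_def)
    have 2: "qbinom n k * (qpoch k * (qpoch m * (1 - fps_X ^ Suc m))) = qpoch n"
      using 3(2) kn nk by simp
    have "qbinom (Suc n) (Suc k) * (qpoch (Suc k) * qpoch (Suc n - Suc k)) =
        fps_X ^ Suc k * (1 - fps_X ^ Suc m) * (qbinom n (Suc k) * (qpoch k * (1
            - fps_X ^ Suc k) * qpoch m))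
        + (1 - fps_X ^ Suc k) * (qbinom n k * (qpoch k * (qpoch m * (1 - fps_X ^ Suc m))))"
      by (simp add: nk algebra_simps del: power_Suc)
    also have "\<dots> = qpoch n * (1 - fps_X ^ Suc k * fps_X ^ Suc m)"
      unfolding 1 2 by (simp add: algebra_simps del: power_Suc)
    also have "fps_X ^ Suc k * fps_X ^ Suc m = (fps_X ^ Suc n :: int fps)"
      by (simp add: n power_add)
    finally show ?thesis by simp
  qed auto
qed auto

lemma qbinom_symmetric: "k \<le> n \<Longrightarrow> qbinom n (n - k) = qbinom n k"
  using qbinom_qpoch[of k n] qbinom_qpoch[of "n - k" n]
  by (auto simp: mult.commute dest: sym)

text \<open>The other q-Pascal rule, obtained from the defining one by symmetry.\<close>

lemma qbinom_Suc_Suc':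
  assumes "k \<le> n"
  shows "qbinom (Suc n) (Suc k) = qbinom n (Suc k) + fps_X ^ (n - k) * qbinom n k"
proof (cases "k = n")
  case False
  with assms have kn: "k < n" by simp
  have "qbinom (Suc n) (Suc k) = qbinom (Suc n) (n - k)"
    using qbinom_symmetric[of "Suc k" "Suc n"] assms by simp
  also have "\<dots> = fps_X ^ (n - k) * qbinom n (n - k) + qbinom n (n - Suc k)"
    using qbinom.simps(3)[of n "n - Suc k"] kn by (simp only: Suc_diff_Suc)
  finally show ?thesis
    using kn qbinom_symmetric[of k n] qbinom_symmetric[of "Suc k" n] by simp
qed auto

text \<open>One application of each q-Pascal rule. The upper index of the triple product is
  \<open>2 * N + 1\<close>, so it moves by two when \<open>N\<close> grows by one.\<close>

lemma qbinom_add_2: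
  assumes "k \<le> n"
  shows "qbinom (n + 2) (Suc (Suc k)) =
    fps_X ^ (k + 2) * qbinom n (Suc (Suc k)) + (1 + fps_X ^ (n + 1)) * qbinom n (Suc k)
    + fps_X ^ (n - k) * qbinom n k"
proof (cases "k = n")
  case False
  with assms have "Suc k \<le> n" by simp
  have "fps_X ^ Suc (Suc k) * fps_X ^ (n - Suc k) = (fps_X ^ (n + 1) :: int fps)"
    using \<open>Suc k \<le> n\<close> by (simp flip: power_add power_Suc)
  have "qbinom (n + 2) (Suc (Suc k)) =
      fps_X ^ Suc (Suc k) * qbinom (Suc n) (Suc (Suc k)) + qbinom (Suc n) (Suc k)"
    by (simp del: power_Suc)
  also have "\<dots> = fps_X ^ Suc (Suc k) * (qbinom n (Suc (Suc k)) + fps_X ^ (n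
      - Suc k) * qbinom n (Suc k))
     + (qbinom n (Suc k) + fps_X ^ (n - k) * qbinom n k)"
    using qbinom_Suc_Suc'[OF assms] qbinom_Suc_Suc'[OF \<open>Suc k \<le> n\<close>] by simp
  also have "\<dots> = fps_X ^ Suc (Suc k) * qbinom n (Suc (Suc k))
      + (fps_X ^ Suc (Suc k) * fps_X ^ (n - Suc k)) * qbinom n (Suc k) + qbinom n (Suc k)
      + fps_X ^ (n - k) * qbinom n k"
    by (simp only: algebra_simps)
  finally show ?thesis
    unfolding \<open>fps_X ^ Suc (Suc k) * fps_X ^ (n - Suc k) = _\<close>
    by (simp add: algebra_simps)
qed (simp add: algebra_simps)


section \<open>Coefficients of the finite triple product\<close>

lemma two_triangle: "2 * triangle n = n * (n + 1)"
  by (induction n) simp_all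

text \<open>The coefficient of \<open>\<chi>\<^sub>n = \<zeta>\<^sup>-\<^sup>n + ... +
  \<zeta>\<^sup>n\<close> in the product of
  \<open>(1 - \<zeta> q^k) (1 - \<zeta>\<^sup>-\<^sup>1 q^k)\<close> over
  \<open>1 <= k <= N\<close>. The value \<open>0\<close> beyond \<open>N\<close> lets the
  recurrences below hold for all \<open>n\<close>.\<close>

definition jtp_coeff :: "nat \<Rightarrow> nat \<Rightarrow> int fps" where
  "jtp_coeff N n = (if n \<le> N then (-1) ^ n * fps_X ^ triangle n * qbinom (2 * N + 1) (N
      - n) else 0)"

text \<open>The new factor of the product is
  \<open>1 - (\<zeta> + \<zeta>\<^sup>-\<^sup>1) q^(N+1) + q^(2N+2)\<close>. At the bottom
  \<open>(\<zeta> + \<zeta>\<^sup>-\<^sup>1) \<chi>\<^sub>0 = \<chi>\<^sub>1 -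
  \<chi>\<^sub>0\<close>, which produces the exceptional difference.\<close>

lemma jtp_coeff_Suc_0:
  "jtp_coeff (Suc N) 0 = (1 + fps_X ^ (2 * N + 2)) * jtp_coeff N 0
     - fps_X ^ (N + 1) * (jtp_coeff N 1 - jtp_coeff N 0)"
proof (cases N)
  case 0
  show ?thesis
    by (simp add: 0 jtp_coeff_def numeral_eq_Suc triangle_Suc algebra_simps)
next
  case (Suc m)
  have sym: "qbinom (2 * N + 1) (Suc N) = qbinom (2 * N + 1) N"
    using qbinom_symmetric[of N "2 * N + 1"] by simp
  have "qbinom (2 * Suc N + 1) (Suc N) = fps_X ^ (N + 1) * qbinom (2 * N + 1) N
       + (1 + fps_X ^ (2 * N + 2)) * qbinom (2 * N + 1) N + fps_X ^ (N + 2) * qbinom (2 * N + 1) m"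
    using qbinom_add_2[of m "2 * N + 1"] sym Suc
    by (simp add: numeral_eq_Suc del: qbinom.simps)
  moreover have "jtp_coeff N 1 = - (fps_X * qbinom (2 * N + 1) m)"
    by (simp add: jtp_coeff_def Suc triangle_Suc)
  ultimately show ?thesis
    by (simp add: jtp_coeff_def algebra_simps)
qed

lemma jtp_coeff_Suc_Suc:
  "jtp_coeff (Suc N) (Suc n) = (1 + fps_X ^ (2 * N + 2)) * jtp_coeff N (Suc n)
     - fps_X ^ (N + 1) * (jtp_coeff N n + jtp_coeff N (n + 2))"
proof -
  \<comment> \<open>The cases differ in which of the coefficients at \<open>n\<close>,
    \<open>n + 1\<close>, \<open>n + 2\<close> vanish because the index exceeds
    \<open>N\<close>.\<close>
  consider "n > N" | "n = N" | "N = Suc n" | k where "N = n + k + 2"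
    by atomize_elim presburger
  then show ?thesis
  proof cases
    case 1
    then show ?thesis by (simp add: jtp_coeff_def)
  next
    case 2
    then show ?thesis by (simp add: jtp_coeff_def triangle_Suc power_add)
  next
    case 3
    have "qbinom (2 * Suc N + 1) 1 = fps_X * qbinom (2 * N + 1) 1 + (1 + fps_X ^ (2 * N + 2))"
      using qbinom_Suc_Suc'[of 0 "2 * N + 1"] by (simp add: algebra_simps)
    moreover have "Suc N - Suc n = 1" "N - n = 1" "N - Suc n = 0" "\<not> n + 2 \<le> N"
      "n \<le> N" "Suc n \<le> N" "Suc n \<le> Suc N"
      using 3 by simp_all
    moreover have "fps_X ^ (N + 1) = (fps_X ^ n * fps_X ^ 2 :: int fps)"
      "triangle (Suc n) = triangle n + n + 1"
      unfolding 3 by (simp_all add: triangle_Suc flip: power_add)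
    ultimately show ?thesis
      unfolding jtp_coeff_def
      by (simp only: if_True if_False power_Suc power_add) (simp add: algebra_simps
          eval_nat_numeral)
  next
    case (4 k)
    have "2 * N + 1 - k = N + n + 3"
      using 4 by simp
    then have "qbinom (2 * Suc N + 1) (Suc (Suc k)) = fps_X ^ (k + 2) * qbinom (2 * N
        + 1) (Suc (Suc k))
        + (1 + fps_X ^ (2 * N + 2)) * qbinom (2 * N + 1) (Suc k)
        + fps_X ^ (N + n + 3) * qbinom (2 * N + 1) k"
      using qbinom_add_2[of k "2 * N + 1"] 4 by simp
    moreover have "Suc N - Suc n = Suc (Suc k)" "N - n = Suc (Suc k)" "N - Suc n = Suc k"
      "N - (n + 2) = k" "n \<le> N" "Suc n \<le> N" "n + 2 \<le> N" "Suc n \<le> Suc N"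
      using 4 by simp_all
    moreover have "triangle (n + 2) = triangle n + n + n + 3" "triangle (Suc n) = triangle n + n
        + 1"
      by (simp_all add: triangle_Suc)
    moreover have "fps_X ^ (N + 1) = (fps_X ^ n * fps_X ^ k * fps_X ^ 3 :: int fps)"
      unfolding 4 by (simp add: power_add numeral_eq_Suc algebra_simps)
    moreover have "fps_X ^ (N + n + 3) = (fps_X ^ (N + 1) * fps_X ^ n * fps_X ^ 2 :: int fps)"
      by (simp add: power_add numeral_eq_Suc algebra_simps)
    ultimately show ?thesis
      unfolding jtp_coeff_def
      by (simp only: if_True power_Suc power_add) (simp add: algebra_simps eval_nat_numeral)
  qed
qed

text \<open>The absolute value of the coefficient of \<open>x\<^sup>a\<close> in \<open>\<zeta>\<^sup>-\<^sup>n + \<dots> + \<zeta>\<^sup>n\<close>,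
  where \<open>\<zeta> + \<zeta>\<^sup>-\<^sup>1 = 2 - x\<close>.\<close>
definition chi_coeff :: "nat \<Rightarrow> nat \<Rightarrow> int" where
  "chi_coeff n a = int ((n + a + 1) choose (2 * a + 1)) + int ((n + a) choose (2 * a + 1))"

lemma chi_coeff_0_right: "chi_coeff n 0 = 2 * int n + 1"
  by (simp add: chi_coeff_def)

lemma chi_coeff_second_difference:
  "chi_coeff (n + 2) (Suc a) = 2 * chi_coeff (n + 1) (Suc a) - chi_coeff n (Suc a)
      + chi_coeff (n + 1) a"
  by (simp add: chi_coeff_def eval_nat_numeral)

text \<open>The initial case \<open>\<chi>\<^sub>1 = (3 - x) \<chi>\<^sub>0\<close>.\<close>

lemma chi_coeff_1_Suc: "chi_coeff 1 (Suc a) = 3 * chi_coeff 0 (Suc a) + chi_coeff 0 a"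
  by (cases a) (simp_all add: chi_coeff_def binomial_eq_0 numeral_3_eq_3)

lemma Suc_times_binomial_Suc_int:
  "int (Suc k) * int (n choose Suc k) = (int n - int k) * int (n choose k)"
proof (induction n arbitrary: k)
  case (Suc n)
  show ?case
  proof (cases k)
    case (Suc j)
    from Suc.IH[of j] Suc.IH[of k] show ?thesis
      by (simp add: Suc algebra_simps)
  qed simp
qed auto

lemma chi_coeff_binomial:
  "int (2 * a + 1) * chi_coeff n a = (2 * int n + 1) * int ((n + a) choose (2 * a))"
  using Suc_times_binomial_Suc_int[of "2 * a" "n + a"]
  by (simp add: chi_coeff_def algebra_simps)

text \<open>Source of the heat equation: \<open>n * (n + 1)\<close> is twice the exponent
  \<open>triangle n\<close>, so multiplication by it acts as \<open>2 \<theta>\<close> on the theta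
  series.\<close>

lemma chi_coeff_Suc_right:
  "int ((2 * a + 2) * (2 * a + 3)) * chi_coeff n (Suc a) =
     (int (n * (n + 1)) - int (a * (a + 1))) * chi_coeff n a"
proof -
  define B where "B = int ((n + a) choose (2 * a))"
  have 1: "int (2 * a + 3) * chi_coeff n (Suc a) = (2 * int n + 1) * int ((n + a
      + 1) choose (2 * a + 2))"
    using chi_coeff_binomial[of "Suc a" n] by (simp add: eval_nat_numeral)
  have 2: "int (2 * a + 2) * int ((n + a + 1) choose (2 * a + 2)) =
      int (n + a + 1) * int ((n + a) choose (2 * a + 1))"
    using Suc_times_binomial_eq[of "n + a" "2 * a + 1"]
    by (simp only: of_nat_mult[symmetric]) (simp add: mult.commute)
  have 3: "int (2 * a + 1) * int ((n + a) choose (2 * a + 1)) = (int n - int a) * B"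
    using Suc_times_binomial_Suc_int[of "2 * a" "n + a"] by (simp add: B_def)
  have 4: "int (2 * a + 1) * chi_coeff n a = (2 * int n + 1) * B"
    using chi_coeff_binomial[of a n] by (simp add: B_def)
  \<comment> \<open>The closed form of \<open>chi_coeff n a\<close> has denominator
    \<open>2 * a + 1\<close>; this nonzero factor is inserted here and cancelled at the end.\<close>
  have "int (2 * a + 1) * (int ((2 * a + 2) * (2 * a + 3)) * chi_coeff n (Suc a)) =
      int (2 * a + 1) * int (2 * a + 2) * (int (2 * a + 3) * chi_coeff n (Suc a))"
    by (simp only: of_nat_mult mult_ac)
  also have "\<dots> = int (2 * a + 1) * (2 * int n + 1) *
      (int (2 * a + 2) * int ((n + a + 1) choose (2 * a + 2)))"
    unfolding 1 by (simp only: mult_ac)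
  also have "\<dots> = (2 * int n + 1) * int (n + a + 1) *
      (int (2 * a + 1) * int ((n + a) choose (2 * a + 1)))"
    unfolding 2 by (simp only: mult_ac)
  also have "\<dots> = int (n + a + 1) * (int n - int a) * (int (2 * a + 1) * chi_coeff n a)"
    unfolding 3 4 by (simp only: mult_ac)
  also have "\<dots> = int (2 * a + 1) * ((int (n * (n + 1)) - int (a * (a + 1))) * chi_coeff n a)"
    by (simp add: algebra_simps)
  finally show ?thesis
    by (simp del: of_nat_mult of_nat_add)
qed

text \<open>The coefficient of \<open>x\<^sup>a\<close> in \<open>\<Prod>\<^sub>k\<^sub>\<le>\<^sub>N ((1 - q\<^sup>k)\<^sup>2 + x q\<^sup>k)\<close>.\<close>
fun theta_prod_coeff :: "nat \<Rightarrow> nat \<Rightarrow> int fps" where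
  "theta_prod_coeff 0 a = (if a = 0 then 1 else 0)"
| "theta_prod_coeff (Suc N) a = (1 - fps_X ^ Suc N)\<^sup>2 * theta_prod_coeff N a
     + fps_X ^ Suc N * (case a of 0 \<Rightarrow> 0 | Suc b \<Rightarrow> theta_prod_coeff N b)"

text \<open>Summation by parts: the symmetric shift is moved from \<open>t\<close> to
  \<open>c\<close>, leaving boundary terms at \<open>0\<close> and \<open>m\<close>.\<close>

lemma sum_by_parts_symmetric:
  fixes t c :: "nat \<Rightarrow> 'a :: comm_ring_1"
  shows "(t 1 - t 0) * c 0 + (\<Sum>n<m. (t n + t (n + 2)) * c (n + 1)) + (t m * c (m + 1) - t (m
      + 1) * c m)
    = t 0 * (c 1 - c 0) + (\<Sum>n<m. t (n + 1) * (c (n + 2) + c n))"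
  by (induction m) (simp_all add: algebra_simps)

text \<open>Induction on \<open>N\<close>: the recurrences of \<open>jtp_coeff\<close> are shifted
  onto \<open>chi_coeff\<close> by parts, where they become multiplication by
  \<open>2 - x\<close>.\<close>

lemma finite_jacobi_triple_product:
  "theta_prod_coeff N a = (-1) ^ a * (\<Sum>n\<le>N. jtp_coeff N n * of_int (chi_coeff n a))"
proof (induction N arbitrary: a)
  case 0
  show ?case
    by (simp add: jtp_coeff_def chi_coeff_def binomial_eq_0)
next
  case (Suc N)
  define Z :: "int fps" where "Z = fps_X ^ Suc N"
  have Z2: "fps_X ^ (2 * N + 2) = Z\<^sup>2" "fps_X ^ (N + 1) = Z"
    by (simp_all add: Z_def mult_2 power_add power2_eq_square)
  define t where "t = jtp_coeff N"
  define c where "c = (\<lambda>n. of_int (chi_coeff n a) :: int fps)"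
  \<comment> \<open>Passing from \<open>a\<close> to its predecessor encodes multiplication by
    \<open>x\<close>.\<close>
  define c' where "c' = (\<lambda>n. of_int (case a of 0 \<Rightarrow> 0 | Suc b \<Rightarrow> chi_coeff n b) :: int fps)"
  have t0: "t n = 0" if "n > N" for n
    using that by (simp add: t_def jtp_coeff_def)
  have c1: "c 1 - c 0 = 2 * c 0 + c' 0"
    unfolding c_def c'_def
    by (cases a) (simp_all add: chi_coeff_0_right chi_coeff_1_Suc[unfolded One_nat_def])
  have c2: "c (n + 2) + c n = 2 * c (n + 1) + c' (n + 1)" for n
    unfolding c_def c'_def using chi_coeff_second_difference[of n]
    by (cases a) (simp_all add: chi_coeff_0_right)
  \<comment> \<open>Summing as far as \<open>Suc N\<close> removes the upper boundary terms, as
    \<open>t\<close> vanishes beyond \<open>N\<close>.\<close>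
  have "(t 1 - t 0) * c 0 + (\<Sum>n<Suc N. (t n + t (n + 2)) * c (n + 1)) =
      t 0 * (c 1 - c 0) + (\<Sum>n<Suc N. t (n + 1) * (c (n + 2) + c n))"
    using sum_by_parts_symmetric[of t c "Suc N"] t0 by simp
  also have "\<dots> = (\<Sum>n<Suc (Suc N). t n * (2 * c n + c' n))"
    unfolding c1 c2 by (subst (2) sum.lessThan_Suc_shift) simp
  also have "\<dots> = 2 * (\<Sum>n\<le>N. t n * c n) + (\<Sum>n\<le>N. t n * c' n)"
    by (simp add: t0 lessThan_Suc_atMost algebra_simps sum.distrib sum_distrib_left)
  finally have parts: "(t 1 - t 0) * c 0 + (\<Sum>n<Suc N. (t n + t (n + 2)) * c (n + 1)) =
      2 * (\<Sum>n\<le>N. t n * c n) + (\<Sum>n\<le>N. t n * c' n)" .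
  have "(\<Sum>n\<le>Suc N. jtp_coeff (Suc N) n * c n) =
      jtp_coeff (Suc N) 0 * c 0 + (\<Sum>n<Suc N. jtp_coeff (Suc N) (Suc n) * c (Suc n))"
    by (simp add: sum.lessThan_Suc_shift flip: lessThan_Suc_atMost del: sum.lessThan_Suc)
  also have "\<dots> = (1 + Z\<^sup>2) * (t 0 * c 0 + (\<Sum>n<Suc N. t (Suc n) * c (Suc n)))
     - Z * ((t 1 - t 0) * c 0 + (\<Sum>n<Suc N. (t n + t (n + 2)) * c (n + 1)))"
    unfolding jtp_coeff_Suc_0 jtp_coeff_Suc_Suc Z2 t_def
    by (simp add: algebra_simps sum.distrib sum_subtractf sum_distrib_left del: sum.lessThan_Suc)
  also have "t 0 * c 0 + (\<Sum>n<Suc N. t (Suc n) * c (Suc n)) = (\<Sum>n<Suc (Suc N). t n * c n)"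
    by (subst (2) sum.lessThan_Suc_shift) simp
  also have "\<dots> = (\<Sum>n\<le>N. t n * c n)"
    by (simp add: t0 lessThan_Suc_atMost)
  finally have main: "(\<Sum>n\<le>Suc N. jtp_coeff (Suc N) n * c n) =
      (1 - Z)\<^sup>2 * (\<Sum>n\<le>N. t n * c n) - Z * (\<Sum>n\<le>N. t n * c' n)"
    unfolding parts by (simp add: algebra_simps power2_eq_square)
  have "theta_prod_coeff (Suc N) a =
      (1 - Z)\<^sup>2 * theta_prod_coeff N a + Z * (case a of 0 \<Rightarrow> 0 | Suc b \<Rightarrow> theta_prod_coeff N b)"
    by (simp add: Z_def)
  also have "(case a of 0 \<Rightarrow> 0 | Suc b \<Rightarrow> theta_prod_coeff N b) = - ((-1) ^ a) * (\<Sum>n\<le>N. t n * c' n)"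
    by (cases a) (simp_all add: Suc.IH t_def c'_def)
  also have "theta_prod_coeff N a = (-1) ^ a * (\<Sum>n\<le>N. t n * c n)"
    by (simp add: Suc.IH t_def c_def)
  also have "(1 - Z)\<^sup>2 * ((-1) ^ a * (\<Sum>n\<le>N. t n * c n)) + Z * (- ((-1) ^ a) * (\<Sum>n\<le>N. t n * c' n)) =
      (-1) ^ a * (\<Sum>n\<le>Suc N. jtp_coeff (Suc N) n * c n)"
    unfolding main by (simp add: algebra_simps)
  finally show ?case
    by (simp only: c_def)
qed

section \<open>The generating functions of MacMahon type\<close>

definition bounded_tuples :: "nat \<Rightarrow> nat \<Rightarrow> nat list set" where
  "bounded_tuples N a = {ks \<in> increasing_tuples a. set ks \<subseteq> {..N}}"

definition MO_sum :: "nat \<Rightarrow> nat \<Rightarrow> int fps" where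
  "MO_sum N a = (\<Sum>ks\<in>bounded_tuples N a. MO_term ks)"

lemma finite_bounded_tuples [simp]: "finite (bounded_tuples N a)"
  by (rule finite_subset[OF _ finite_lists_length_eq[of "{..N}" a]])
     (auto simp: bounded_tuples_def increasing_tuples_def)

lemma bounded_tuples_0_right: "bounded_tuples N 0 = {[]}"
  by (auto simp: bounded_tuples_def increasing_tuples_def)

lemma bounded_tuples_0_Suc: "bounded_tuples 0 (Suc a) = {}"
  by (auto simp: bounded_tuples_def increasing_tuples_def length_Suc_conv)

lemma append_in_increasing_tuples:
  "js @ [j] \<in> increasing_tuples (Suc a) \<longleftrightarrow>
     js \<in> increasing_tuples a \<and> 0 < j \<and> (\<forall>k\<in>set js. k < j)"
  by (auto simp: increasing_tuples_def sorted_wrt_append)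

text \<open>Tuples are sorted by whether their last entry is \<open>Suc N\<close>.\<close>

lemma bounded_tuples_Suc_Suc:
  "bounded_tuples (Suc N) (Suc a) =
     bounded_tuples N (Suc a) \<union> (\<lambda>ks. ks @ [Suc N]) ` bounded_tuples N a"
proof (intro equalityI subsetI)
  fix ks assume ks: "ks \<in> bounded_tuples (Suc N) (Suc a)"
  then obtain js j where js: "ks = js @ [j]"
    by (cases ks rule: rev_cases) (auto simp: bounded_tuples_def increasing_tuples_def)
  have *: "js \<in> increasing_tuples a" "\<forall>k\<in>set js. k < j" "j \<le> Suc N" "ks \<in> increasing_tuples (Suc a)"
    using ks by (simp_all add: bounded_tuples_def js append_in_increasing_tuples)
  show "ks \<in> bounded_tuples N (Suc a) \<union> (\<lambda>ks. ks @ [Suc N]) ` bounded_tuples N a"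
  proof (cases "j = Suc N")
    case True
    with * have "js \<in> bounded_tuples N a"
      by (auto simp: bounded_tuples_def)
    with True js show ?thesis by simp
  next
    case False
    have "k \<le> N" if "k \<in> set ks" for k
      using that * False js by (cases "k = j") fastforce+
    with * show ?thesis
      by (auto simp: bounded_tuples_def)
  qed
next
  fix ks assume "ks \<in> bounded_tuples N (Suc a) \<union> (\<lambda>ks. ks @ [Suc N]) ` bounded_tuples N a"
  then show "ks \<in> bounded_tuples (Suc N) (Suc a)"
    by (auto simp: bounded_tuples_def append_in_increasing_tuples less_Suc_eq_le intro: le_SucI)
qed

lemma MO_denom_mult_MO_term:
  "ks \<in> increasing_tuples a \<Longrightarrow> MO_denom ks * MO_term ks = fps_X ^ sum_list ks"
  using MO_denom_inverse[of ks a] by (simp add: MO_term_def algebra_simps)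

lemma MO_term_append:
  assumes "ks \<in> bounded_tuples N a"
  shows "(1 - fps_X ^ Suc N)\<^sup>2 * MO_term (ks @ [Suc N]) = fps_X ^ Suc N * MO_term ks"
proof -
  have ks: "ks \<in> increasing_tuples a"
    using assms by (simp add: bounded_tuples_def)
  have "ks @ [Suc N] \<in> increasing_tuples (Suc a)"
    using assms bounded_tuples_Suc_Suc[of N a] by (auto simp: bounded_tuples_def)
  from MO_denom_mult_MO_term[OF this]
  have "MO_denom ks * ((1 - fps_X ^ Suc N)\<^sup>2 * MO_term (ks @ [Suc N])) =
      fps_X ^ Suc N * fps_X ^ sum_list ks"
    by (simp add: MO_denom_def power_add algebra_simps)
  also have "\<dots> = MO_denom ks * (fps_X ^ Suc N * MO_term ks)"
    using MO_denom_mult_MO_term[OF ks] by (simp add: algebra_simps)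
  finally show ?thesis
    using MO_denom_inverse[OF ks] by (auto simp del: power_Suc)
qed

lemma MO_sum_Suc_Suc:
  "(1 - fps_X ^ Suc N)\<^sup>2 * MO_sum (Suc N) (Suc a) =
     (1 - fps_X ^ Suc N)\<^sup>2 * MO_sum N (Suc a) + fps_X ^ Suc N * MO_sum N a"
proof -
  have "bounded_tuples N (Suc a) \<inter> (\<lambda>ks. ks @ [Suc N]) ` bounded_tuples N a = {}"
    by (auto simp: bounded_tuples_def)
  then have "MO_sum (Suc N) (Suc a) =
      MO_sum N (Suc a) + (\<Sum>ks\<in>bounded_tuples N a. MO_term (ks @ [Suc N]))"
    unfolding MO_sum_def bounded_tuples_Suc_Suc
    by (subst sum.union_disjoint) (simp_all add: sum.reindex inj_on_def)
  moreover have "(1 - fps_X ^ Suc N)\<^sup>2 * (\<Sum>ks\<in>bounded_tuples N a. MO_term (ks @ [Suc N])) =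
      fps_X ^ Suc N * MO_sum N a"
    unfolding MO_sum_def sum_distrib_left by (intro sum.cong refl MO_term_append)
  ultimately show ?thesis
    by (simp only: distrib_left)
qed

lemma MO_term_Nil [simp]: "MO_term [] = 1"
  using MO_denom_mult_MO_term[of "[]" 0] by (simp add: MO_denom_def increasing_tuples_def)

text \<open>Expanding the product, a tuple records the factors from which \<open>x q^k\<close> is
  taken. After multiplication by the squared denominators both sides obey the same recurrence in
  \<open>N\<close>.\<close>

lemma theta_prod_coeff_eq: "theta_prod_coeff N a = (qpoch N)\<^sup>2 * MO_sum N a"
proof (induction N arbitrary: a)
  case 0
  show ?case
    by (cases a) (simp_all add: MO_sum_def bounded_tuples_0_right bounded_tuples_0_Suc)
next
  case (Suc N)
  show ?case
  proof (cases a)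
    case 0
    with Suc show ?thesis
      by (simp add: MO_sum_def bounded_tuples_0_right power_mult_distrib)
  next
    case (Suc b)
    have "(qpoch (Suc N))\<^sup>2 * MO_sum (Suc N) a =
        (qpoch N)\<^sup>2 * ((1 - fps_X ^ Suc N)\<^sup>2 * MO_sum (Suc N) (Suc b))"
      by (simp only: Suc qpoch_Suc power_mult_distrib mult_ac)
    then show ?thesis
      unfolding MO_sum_Suc_Suc by (simp add: Suc Suc.IH algebra_simps)
  qed
qed

text \<open>A tuple contributes only in degrees at least its sum, so an entry above \<open>N\<close>
  makes it invisible modulo \<open>q^(N+1)\<close>.\<close>

lemma trunc_eq_MO_fps: "trunc_eq (Suc N) (MO_fps a) (MO_sum N a)"
proof -
  define A where "A = (\<lambda>n. {ks \<in> increasing_tuples a. fps_nth (MO_term ks) n \<noteq> 0})"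
  have sub: "A n \<subseteq> bounded_tuples n a" for n
  proof
    fix ks assume ks: "ks \<in> A n"
    then have "sum_list ks \<le> n"
      by (auto simp: A_def MO_term_def fps_X_power_mult_nth split: if_splits)
    with ks show "ks \<in> bounded_tuples n a"
      using member_le_sum_list[of _ ks] by (fastforce simp: A_def bounded_tuples_def)
  qed
  then have fin: "finite (A n)" for n
    by (rule finite_subset) simp
  define S where "S = Abs_fps (\<lambda>n. \<Sum>ks\<in>A n. fps_nth (MO_term ks) n)"
  have "(MO_term has_sum S) (increasing_tuples a)"
    by (rule has_sum_fpsI) (use fin in \<open>simp_all add: S_def A_def\<close>)
  then have MO: "MO a n = (\<Sum>ks\<in>A n. fps_nth (MO_term ks) n)" for n
    by (simp add: MO_def infsumI S_def)
  show ?thesis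
    unfolding trunc_eq_def
  proof (intro allI impI)
    fix n assume n: "n < Suc N"
    have "(\<Sum>ks\<in>A n. fps_nth (MO_term ks) n) = (\<Sum>ks\<in>bounded_tuples N a. fps_nth (MO_term ks) n)"
    proof (rule sum.mono_neutral_left)
      show "A n \<subseteq> bounded_tuples N a"
        using sub[of n] n by (fastforce simp: bounded_tuples_def)
    qed (simp, auto simp: A_def bounded_tuples_def)
    then show "fps_nth (MO_fps a) n = fps_nth (MO_sum N a) n"
      by (simp add: MO_fps_def MO MO_sum_def fps_sum_nth)
  qed
qed

section \<open>Passage to the infinite triple product and the heat equation\<close>

lemma triangle_ge: "n \<le> triangle n"
  by (induction n) (auto simp: triangle_Suc)

text \<open>By the quotient formula the Gaussian binomial is the inverse Euler product modulo
  \<open>q^(N-n+1)\<close>.\<close>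

lemma trunc_eq_qpoch_jtp_coeff:
  assumes "n \<le> N"
  shows "trunc_eq (Suc N) (qpoch N * jtp_coeff N n) ((-1) ^ n * fps_X ^ triangle n)"
proof -
  define m where "m = N - n"
  define b where "b = qbinom (2 * N + 1) m"
  have q: "trunc_eq (Suc m) (qpoch M) (qpoch m)" if "M \<ge> m" for M
    by (rule trunc_eq_qpoch) fact
  have "trunc_eq (Suc m) (qpoch m * (qpoch m * b)) (qpoch m * qpoch (2 * N + 1 - m) * b)"
    unfolding mult.assoc by (intro trunc_eq_mult trunc_eq_refl trunc_eq_sym[OF q]) (simp add: m_def)
  also have "qpoch m * qpoch (2 * N + 1 - m) * b = qpoch (2 * N + 1)"
    using qbinom_qpoch[of m "2 * N + 1"] by (simp add: b_def m_def algebra_simps)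
  also have "trunc_eq (Suc m) (qpoch (2 * N + 1)) (qpoch m * 1)"
    using q[of "2 * N + 1"] by (simp add: m_def)
  finally have "trunc_eq (Suc m) (qpoch m * b) 1"
    by (rule trunc_eq_mult_cancel) simp
  with trunc_eq_mult[OF q[of N] trunc_eq_refl[of _ b]] have "trunc_eq (Suc m) (qpoch N * b) 1"
    by (auto simp: m_def intro: trunc_eq_trans)
  from trunc_eq_mult[OF trunc_eq_refl[of _ "(-1) ^ n"] trunc_eq_fps_X_power_mult[OF this, of
      "triangle n"]]
  have "trunc_eq (Suc m + triangle n) ((-1) ^ n * (fps_X ^ triangle n * (qpoch N * b)))
      ((-1) ^ n * (fps_X ^ triangle n * 1))" .
  \<comment> \<open>The \<open>n\<close> degrees of precision lost above are regained from the
    factor \<open>q^(triangle n)\<close>, because \<open>n <= triangle n\<close>.\<close>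
  then have "trunc_eq (Suc N) ((-1) ^ n * (fps_X ^ triangle n * (qpoch N * b)))
      ((-1) ^ n * (fps_X ^ triangle n * 1))"
    by (rule trunc_eq_mono) (use triangle_ge[of n] assms in \<open>simp add: m_def\<close>)
  then show ?thesis
    using assms by (simp add: jtp_coeff_def b_def m_def algebra_simps)
qed

definition theta_fps :: "nat \<Rightarrow> int fps" where
  "theta_fps a = euler_fps ^ 3 * MO_fps a"

lemma trunc_eq_theta_fps:
  "trunc_eq (Suc N) (theta_fps a)
     ((-1) ^ a * (\<Sum>n\<le>N. (-1) ^ n * fps_X ^ triangle n * of_int (chi_coeff n a)))"
proof -
  have "trunc_eq (Suc N) (theta_fps a) (qpoch N ^ 3 * MO_sum N a)"
    unfolding theta_fps_def
    by (intro trunc_eq_mult trunc_eq_power trunc_eq_euler trunc_eq_MO_fps)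
  also have "qpoch N ^ 3 * MO_sum N a = qpoch N * theta_prod_coeff N a"
    by (simp add: theta_prod_coeff_eq power3_eq_cube power2_eq_square algebra_simps)
  also have "\<dots> = (-1) ^ a * (\<Sum>n\<le>N. qpoch N * jtp_coeff N n * of_int (chi_coeff n a))"
    by (simp add: finite_jacobi_triple_product sum_distrib_left algebra_simps)
  also have "trunc_eq (Suc N) \<dots>
      ((-1) ^ a * (\<Sum>n\<le>N. (-1) ^ n * fps_X ^ triangle n * of_int (chi_coeff n a)))"
    by (intro trunc_eq_mult trunc_eq_sum trunc_eq_refl trunc_eq_qpoch_jtp_coeff) auto
  finally show ?thesis .
qed

lemma theta_fps_nth:
  "fps_nth (theta_fps a) j =
     (-1) ^ a * (\<Sum>n\<le>j. if triangle n = j then (-1) ^ n * chi_coeff n a else 0)"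
proof -
  have eq: "(-1) ^ n * fps_X ^ triangle n * of_int (chi_coeff n a) =
      fps_const ((-1) ^ n * chi_coeff n a) * fps_X ^ triangle n" for n
    by (simp add: fps_of_int[symmetric] fps_const_power[symmetric] fps_const_neg[symmetric]
          algebra_simps flip: fps_const_mult)
  have eq': "(-1 :: int fps) ^ a = fps_const ((-1) ^ a)"
    by (simp add: fps_const_power[symmetric] fps_const_neg[symmetric])
  have "fps_nth (theta_fps a) j = fps_nth ((-1) ^ a * (\<Sum>n\<le>j. (-1) ^ n * fps_X ^ triangle n *
      of_int (chi_coeff n a))) j"
    using trunc_eq_theta_fps[of j a] by (simp add: trunc_eq_def)
  also have "\<dots> = (-1) ^ a * (\<Sum>n\<le>j. if triangle n = j then (-1) ^ n * chi_coeff n a else 0)"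
    unfolding eq eq' fps_mult_left_const_nth fps_sum_nth
    by (auto intro!: arg_cong2[of _ _ _ _ "(*)"] sum.cong simp: fps_X_power_nth)
  finally show ?thesis .
qed

lemma MO_fps_0 [simp]: "MO_fps 0 = 1"
proof (rule fps_eq_trunc_eqI)
  fix m
  show "trunc_eq m (MO_fps 0) 1"
    using trunc_eq_MO_fps[of m 0]
    by (auto simp: MO_sum_def bounded_tuples_0_right intro: trunc_eq_mono)
qed

text \<open>The heat equation satisfied by the theta function, coefficientwise.\<close>
lemma theta_fps_Suc_nth:
  "int ((2 * a + 2) * (2 * a + 3)) * fps_nth (theta_fps (Suc a)) j =
     - (2 * int j - int (a * (a + 1))) * fps_nth (theta_fps a) j"
proof -
  have "int ((2 * a + 2) * (2 * a + 3)) * (if triangle n = j then (-1) ^ n * chi_coeff n (Suc a)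
      else 0) =
      (2 * int j - int (a * (a + 1))) * (if triangle n = j then (-1) ^ n * chi_coeff n a else
          0)" for n
  proof (cases "triangle n = j")
    case True
    then have "int (n * (n + 1)) = int (2 * j)"
      using two_triangle[of n] by (simp only:)
    then have "int (n * (n + 1)) = 2 * int j"
      by simp
    with chi_coeff_Suc_right[of a n]
    have "int ((2 * a + 2) * (2 * a + 3)) * chi_coeff n (Suc a) =
        (2 * int j - int (a * (a + 1))) * chi_coeff n a"
      by simp
    from arg_cong[OF this, of "(*) ((-1) ^ n)"] True show ?thesis
      by (simp only: if_True simp_thms mult_ac)
  qed simp
  then have "int ((2 * a + 2) * (2 * a + 3)) * (\<Sum>n\<le>j. if triangle n
      = j then (-1) ^ n * chi_coeff n (Suc a) else 0) =
      (2 * int j - int (a * (a + 1))) * (\<Sum>n\<le>j. if triangle n = j then (-1) ^ n * chi_coeff n a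
          else 0)"
    unfolding sum_distrib_left by (intro sum.cong refl)
  from arg_cong[OF this, of "(*) (- ((-1) ^ a))"] show ?thesis
    unfolding theta_fps_nth power_Suc by (simp only: mult_ac mult_minus_left mult_minus_right
        mult_1_left)
qed

text \<open>For \<open>p\<close> dividing \<open>a + 1\<close>, both \<open>2 * a + 2\<close> and
  \<open>a * (a + 1)\<close> vanish modulo \<open>p\<close>, so the heat equation reduces to
  \<open>2 j B = 0\<close>; here \<open>2\<close> and \<open>j\<close> are units.\<close>

lemma theta_fps_nth_dvd:
  fixes p :: nat
  assumes "prime p" "odd p" "p dvd Suc a" "\<not> p dvd j"
  shows "int p dvd fps_nth (theta_fps a) j"
proof -
  have "int p dvd int ((2 * a + 2) * (2 * a + 3))"
  proof -
    have "p dvd 2 * Suc a * (2 * a + 3)"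
      using assms(3) by (intro dvd_mult2 dvd_mult)
    then show ?thesis
      by (simp only: int_dvd_int_iff mult_Suc_right) (simp add: add.commute)
  qed
  moreover have "int p dvd int (a * (a + 1))"
    using assms(3) by (simp only: int_dvd_int_iff Suc_eq_plus1 dvd_mult)
  moreover have "2 * int j * fps_nth (theta_fps a) j =
      int (a * (a + 1)) * fps_nth (theta_fps a) j
      - int ((2 * a + 2) * (2 * a + 3)) * fps_nth (theta_fps (Suc a)) j"
    unfolding theta_fps_Suc_nth by (simp add: algebra_simps)
  ultimately have "int p dvd 2 * int j * fps_nth (theta_fps a) j"
    by (metis dvd_diff dvd_mult2)
  moreover have "prime (int p)" "\<not> int p dvd int j"
    using assms by simp_all
  moreover have "\<not> int p dvd 2"
    using assms(1,2) by (metis int_dvd_int_iff of_nat_numeral primes_dvd_imp_eq two_is_prime_nat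
        dvd_refl)
  ultimately show ?thesis
    by (auto simp: prime_dvd_mult_iff)
qed

text \<open>At \<open>j = triangle n\<close> one has \<open>8 * j + 1 = (2 * n + 1)^2\<close>, and
  the coefficient of \<open>E^3\<close> carries a further factor \<open>2 * n + 1\<close>, so the
  left side contains \<open>(2 * n + 1)^p\<close>.\<close>

lemma euler_cube_nth_cong:
  fixes p :: nat
  assumes "prime p" "odd p"
  shows "[int (8 * j + 1) ^ ((p - 1) div 2) * fps_nth (euler_fps ^ 3) j
    = fps_nth (euler_fps ^ 3) j] (mod int p)"
proof -
  have cong: "[int (8 * j + 1) ^ ((p - 1) div 2) * (if triangle n = j then (-1) ^ n * (2 * int n
      + 1) else 0)
      = (if triangle n = j then (-1) ^ n * (2 * int n + 1) else 0)] (mod int p)" for n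
  proof (cases "triangle n = j")
    case True
    have "8 * j + 1 = (2 * n + 1)\<^sup>2"
      using two_triangle[of n] True by (simp add: power2_eq_square algebra_simps)
    moreover have "2 * ((p - 1) div 2) = p - 1"
      using assms(2) by simp
    ultimately have pow: "(8 * j + 1) ^ ((p - 1) div 2) = (2 * n + 1) ^ (p - 1)"
      by (metis power_mult)
    have "[(2 * n + 1) ^ (p - 1) * (2 * n + 1) = 2 * n + 1] (mod p)"
    proof (cases "p dvd 2 * n + 1")
      case True
      then show ?thesis by (metis cong_0_iff cong_sym cong_trans dvd_mult)
    next
      case False
      from cong_scalar_right[OF fermat_theorem[OF assms(1) False], of "2 * n + 1"]
      show ?thesis by simp
    qed
    then have "[int ((8 * j + 1) ^ ((p - 1) div 2) * (2 * n + 1)) = int (2 * n + 1)] (mod int p)"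
      unfolding pow by (simp only: cong_int_iff)
    from cong_scalar_left[OF this, of "(-1) ^ n"] True show ?thesis
      by (simp add: algebra_simps)
  qed simp
  have "fps_nth (euler_fps ^ 3) j = (\<Sum>n\<le>j. if triangle n = j then (-1) ^ n * (2 * int n
      + 1) else 0)"
    using theta_fps_nth[of 0 j] by (simp add: theta_fps_def chi_coeff_0_right cong: if_cong)
  then show ?thesis
    by (simp only: sum_distrib_left) (intro cong_sum cong)
qed

section \<open>Convolution sums of divisor functions\<close>

text \<open>Factorizations are kept as pairs instead of divisors, so that bijections can act on all
  factors.\<close>

definition divpairs :: "nat \<Rightarrow> (nat \<times> nat) set" where
  "divpairs n = {(a, x). 0 < a \<and> 0 < x \<and> a * x = n}"

definition reps :: "nat \<Rightarrow> (nat \<times> nat \<times> nat \<times> nat) set" where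
  "reps n = {(a, x, b, y). 0 < a \<and> 0 < x \<and> 0 < b \<and> 0 < y \<and> a * x + b * y = n}"

definition sigma_fps :: "nat \<Rightarrow> int fps" where
  "sigma_fps k = Abs_fps (\<lambda>n. \<Sum>(a, x)\<in>divpairs n. int a ^ k)"

lemma finite_divpairs [simp]: "finite (divpairs n)"
  by (rule finite_subset[of _ "{..n} \<times> {..n}"]) (auto simp: divpairs_def)

lemma finite_reps [simp]: "finite (reps n)"
proof (rule finite_subset)
  have "a \<le> n" "x \<le> n" "b \<le> n" "y \<le> n" if "(a, x, b, y) \<in> reps n" for a x b y
  proof -
    from that have "a \<le> a * x" "x \<le> a * x" "b \<le> b * y" "y \<le> b * y" "a * x + b * y = n"
      by (simp_all add: reps_def)
    then show "a \<le> n" "x \<le> n" "b \<le> n" "y \<le> n"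
      by (auto intro: trans_le_add1 trans_le_add2)
  qed
  then show "reps n \<subseteq> {..n} \<times> {..n} \<times> {..n} \<times> {..n}" by auto
qed simp

lemma divpairs_0 [simp]: "divpairs 0 = {}"
  by (auto simp: divpairs_def)

lemma sum_reps_eq_mult_nth:
  "(\<Sum>(a, x, b, y)\<in>reps n. int a ^ i * int b ^ j) = fps_nth (sigma_fps i * sigma_fps j) n"
proof -
  have "fps_nth (sigma_fps i * sigma_fps j) n =
      (\<Sum>k=0..n. \<Sum>((a, x), (b, y))\<in>divpairs k \<times> divpairs (n - k). int a ^ i * int b ^ j)"
    unfolding fps_mult_nth sigma_fps_def fps_nth_Abs_fps sum_product sum.cartesian_product
    by (simp add: case_prod_unfold)
  also have "\<dots> = (\<Sum>(k, (a, x), (b, y))\<in>(SIGMA k:{0..n}. divpairs k \<times> divpairs (n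
      - k)). int a ^ i * int b ^ j)"
    by (subst sum.Sigma) (auto simp: case_prod_unfold)
  also have "\<dots> = (\<Sum>(a, x, b, y)\<in>reps n. int a ^ i * int b ^ j)"
    by (rule sum.reindex_bij_witness[where
          i = "\<lambda>(a, x, b, y). (a * x, (a, x), (b, y))" and
          j = "\<lambda>(k, (a, x), (b, y)). (a, x, b, y)"])
       (auto simp: divpairs_def reps_def)
  finally show ?thesis ..
qed

text \<open>Since \<open>a * x = n\<close>, a weight \<open>x\<close> trades one power of
  \<open>a\<close> for a factor \<open>n\<close>. This is the origin of the \<open>\<theta>\<close>
  terms in the convolution identities.\<close>

lemma sum_divpairs_cofactor:
  "(\<Sum>(a, x)\<in>divpairs n. (int x - 1) * int a ^ Suc k) =
     int n * fps_nth (sigma_fps k) n - fps_nth (sigma_fps (Suc k)) n"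
proof -
  have "(\<Sum>(a, x)\<in>divpairs n. (int x - 1) * int a ^ Suc k) =
      (\<Sum>(a, x)\<in>divpairs n. int n * int a ^ k - int a ^ Suc k)"
    by (rule sum.cong) (auto simp: divpairs_def algebra_simps)
  then show ?thesis
    by (simp add: sigma_fps_def case_prod_unfold sum_subtractf sum_distrib_left)
qed

text \<open>Splitting the solutions of \<open>a x + b y = n\<close> according to the sign of \<open>x - y\<close> and of
  \<open>b - a\<close> gives two families in bijection by \<open>(a, x, b, y) \<mapsto> (a, x - y, a + b, y)\<close>.\<close>
lemma sum_reps_shear:
  fixes g :: "int \<Rightarrow> int \<Rightarrow> int"
  assumes sym: "\<And>a b. g a b = g b a" and sym': "\<And>a b. g a (b - a) = g b (a - b)"
  shows "(\<Sum>(a, x, b, y)\<in>reps n. g (int a) (int b - int a) - g (int a) (int b)) =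
    (\<Sum>(a, x)\<in>divpairs n. (int x - 1) * g (int a) 0)
    - (\<Sum>(a, x)\<in>divpairs n. \<Sum>i=1..<a. g (int i) (int a - int i))"
proof -
  define G where "G = (\<lambda>(a, x :: nat, b, y :: nat). g (int a) (int b))"
  define H where "H = (\<lambda>(a, x :: nat, b, y :: nat). g (int a) (int b - int a))"
  define swap where "swap = (\<lambda>(a, x, b, y). (b, y, a, x) :: nat \<times> nat \<times> nat \<times> nat)"
  define X1 where "X1 = {(a, x, b, y). (a, x, b, y) \<in> reps n \<and> x > y}"
  define X2 where "X2 = {(a, x, b, y). (a, x, b, y) \<in> reps n \<and> x < y}"
  define X3 where "X3 = {(a, x, b, y). (a, x, b, y) \<in> reps n \<and> x = y}"
  define A1 where "A1 = {(a, x, b, y). (a, x, b, y) \<in> reps n \<and> b > a}"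
  define A2 where "A2 = {(a, x, b, y). (a, x, b, y) \<in> reps n \<and> b < a}"
  define A3 where "A3 = {(a, x, b, y). (a, x, b, y) \<in> reps n \<and> b = a}"
  have fin: "finite X1" "finite X2" "finite X3" "finite A1" "finite A2" "finite A3"
    unfolding X1_def X2_def X3_def A1_def A2_def A3_def
    by (auto intro: finite_subset[OF _ finite_reps[of n]])
  have "reps n = (X1 \<union> X2) \<union> X3" "X1 \<inter> X2 = {}" "(X1 \<union> X2) \<inter> X3 = {}"
    by (auto simp: X1_def X2_def X3_def)
  then have splitG: "sum G (reps n) = sum G X1 + sum G X2 + sum G X3"
    using fin by (simp add: sum.union_disjoint)
  have "reps n = (A1 \<union> A2) \<union> A3" "A1 \<inter> A2 = {}" "(A1 \<union> A2) \<inter> A3 = {}"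
    by (auto simp: A1_def A2_def A3_def)
  then have splitH: "sum H (reps n) = sum H A1 + sum H A2 + sum H A3"
    using fin by (simp add: sum.union_disjoint)
  \<comment> \<open>Exchanging the summands \<open>a x\<close> and \<open>b y\<close> swaps the two
    strict inequalities, so only one strict half remains on each side.\<close>
  have X21: "sum G X2 = sum G X1"
    by (rule sum.reindex_bij_witness[where i = swap and j = swap])
       (auto simp: swap_def X1_def X2_def reps_def G_def sym)
  have A21: "sum H A2 = sum H A1"
    by (rule sum.reindex_bij_witness[where i = swap and j = swap])
       (auto simp: swap_def A1_def A2_def reps_def H_def sym')
  have shear: "a * (x - y) + (a + b) * y = a * x + b * y" if "y < x" for a x b y :: nat
  proof -
    have "a * (x - y) + a * y = a * x"
      using that by (simp flip: distrib_left)
    then show ?thesis by (simp add: distrib_right)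
  qed
  have shear': "a * (x + y) + (b - a) * y = a * x + b * y" if "a < b" for a x b y :: nat
  proof -
    have "(b - a) * y + a * y = b * y"
      using that by (simp flip: distrib_right)
    then show ?thesis by (simp add: distrib_left)
  qed
  define i where "i = (\<lambda>(a, x, b, y). (a, x + y, b - a, y) :: nat \<times> nat \<times> nat \<times> nat)"
  define j where "j = (\<lambda>(a, x, b, y). (a, x - y, a + b, y) :: nat \<times> nat \<times> nat \<times> nat)"
  have X1A1: "sum G X1 = sum H A1"
  proof (rule sum.reindex_bij_witness[where i = i and j = j])
    show "i (j t) = t" "j t \<in> A1" "H (j t) = G t" if "t \<in> X1" for t
      using that by (auto simp: i_def j_def X1_def A1_def reps_def G_def H_def shear)
    show "j (i t) = t" "i t \<in> X1" if "t \<in> A1" for t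
      using that by (auto simp: i_def j_def X1_def A1_def reps_def shear')
  qed
  have split_factor: "k * x + (a - k) * x = a * x" and split_cofactor: "x * k + x * (a - k) = x * a"
    if "k < a" for a k x :: nat
    using that by (simp_all flip: distrib_right distrib_left)
  \<comment> \<open>With \<open>x = y\<close> the equation reads \<open>(a + b) * x = n\<close>: a
    factorization together with a splitting of its first factor.\<close>
  have X3: "sum G X3 = (\<Sum>(a, x)\<in>divpairs n. \<Sum>i=1..<a. g (int i) (int a - int i))"
  proof -
    have "(\<Sum>(a, x)\<in>divpairs n. \<Sum>i=1..<a. g (int i) (int a - int i)) =
        (\<Sum>((a, x), i)\<in>(SIGMA (a, x):divpairs n. {1..<a}). g (int i) (int a - int i))"
      by (simp add: case_prod_unfold sum.Sigma)
    also have "\<dots> = sum G X3"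
      by (rule sum.reindex_bij_witness[where
            i = "\<lambda>(a, x, b, y). ((a + b, x), a)" and
            j = "\<lambda>((a, x), i). (i, x, a - i, x)"])
         (auto simp: X3_def reps_def divpairs_def G_def split_factor distrib_right)
    finally show ?thesis ..
  qed
  \<comment> \<open>With \<open>a = b\<close> the equation reads \<open>a * (x + y) = n\<close>, and
    a cofactor \<open>x\<close> splits in \<open>x - 1\<close> ways.\<close>
  have A3: "sum H A3 = (\<Sum>(a, x)\<in>divpairs n. (int x - 1) * g (int a) 0)"
  proof -
    have "(\<Sum>(a, x)\<in>divpairs n. (int x - 1) * g (int a) 0) =
        (\<Sum>(a, x)\<in>divpairs n. \<Sum>i=1..<x. g (int a) 0)"
      by (rule sum.cong) (auto simp: divpairs_def of_nat_diff)
    also have "\<dots> = (\<Sum>((a, x), i)\<in>(SIGMA (a, x):divpairs n. {1..<x}). g (int a) 0)"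
      by (simp add: case_prod_unfold sum.Sigma del: sum_constant)
    also have "\<dots> = sum H A3"
      by (rule sum.reindex_bij_witness[where
            i = "\<lambda>(a, x, b, y). ((a, x + y), x)" and
            j = "\<lambda>((a, x), i). (a, i, a, x - i)"])
         (auto simp: A3_def reps_def divpairs_def H_def split_cofactor distrib_left)
    finally show ?thesis ..
  qed
  have "(\<Sum>(a, x, b, y)\<in>reps n. g (int a) (int b - int a) - g (int a) (int b)) =
      sum H (reps n) - sum G (reps n)"
    by (simp add: G_def H_def case_prod_unfold sum_subtractf)
  then show ?thesis
    unfolding splitG splitH X21 A21 X1A1 X3 A3 by simp
qed

text \<open>Faulhaber's formulas without denominators, in terms of the exclusive upper bound
  \<open>M\<close>.\<close>

lemma power_sums:
  fixes m :: nat
  defines "M \<equiv> int m + 1"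
  shows "2 * (\<Sum>i=1..<Suc m. int i) = M * (M - 1)"
    and "6 * (\<Sum>i=1..<Suc m. int i ^ 2) = M * (M - 1) * (2 * M - 1)"
    and "4 * (\<Sum>i=1..<Suc m. int i ^ 3) = M ^ 2 * (M - 1) ^ 2"
    and "30 * (\<Sum>i=1..<Suc m. int i ^ 4) = M * (M - 1) * (2 * M - 1) * (3 * M ^ 2 - 3 * M - 1)"
    and "12 * (\<Sum>i=1..<Suc m. int i ^ 5) = M ^ 2 * (M - 1) ^ 2 * (2 * M ^ 2 - 2 * M - 1)"
    and "42 * (\<Sum>i=1..<Suc m. int i ^ 6) =
      M * (M - 1) * (2 * M - 1) * (3 * M ^ 4 - 6 * M ^ 3 + 3 * M + 1)"
  unfolding M_def
  by (induction m) (simp_all add: eval_nat_numeral algebra_simps)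


lemma fps_numeral_mult_nth [simp]: "fps_nth (numeral k * f) n = numeral k * fps_nth f n"
  for f :: "int fps"
  by (simp add: numeral_fps_const)

text \<open>Form of \<open>sum_reps_shear\<close> for polynomials: \<open>K\<close> clears the
  denominators of the power sums and \<open>q\<close> is the resulting diagonal polynomial.\<close>

lemma sum_reps_shear_poly:
  fixes g h :: "int \<Rightarrow> int \<Rightarrow> int" and K :: int
  assumes sym: "\<And>a b. g a b = g b a" and sym': "\<And>a b. g a (b - a) = g b (a - b)"
    and h: "\<And>a b. g a (b - a) - g a b = h a b"
    and diag: "\<And>a. 0 < a \<Longrightarrow> K * (\<Sum>i=1..<a. g (int i) (int a - int i)) = q (int a)"
  shows "K * (\<Sum>(a, x, b, y)\<in>reps n. h (int a) (int b)) =
    K * (\<Sum>(a, x)\<in>divpairs n. (int x - 1) * g (int a) 0) - (\<Sum>(a, x)\<in>divpairs n. q (int a))"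
proof -
  have "K * (\<Sum>(a, x)\<in>divpairs n. \<Sum>i=1..<a. g (int i) (int a - int i)) =
      (\<Sum>(a, x)\<in>divpairs n. q (int a))"
    unfolding sum_distrib_left[where A = "divpairs n"]
    by (rule sum.cong) (auto simp: divpairs_def diag[unfolded One_nat_def])
  with sum_reps_shear[of g n, OF sym sym'] show ?thesis
    by (simp add: h right_diff_distrib)
qed

text \<open>Powers of \<open>a\<^sup>2 + a b + b\<^sup>2\<close> and of \<open>(a b (a + b))\<^sup>2\<close> have both symmetries required by
  \<open>sum_reps_shear\<close>. For the latter, \<open>g a (b - a) - g a b = - 4 a\<^sup>3 b\<^sup>3\<close>, which isolates the
  convolution of \<open>\<sigma>\<^sub>3\<close> with itself.\<close>
lemma sum_norm_form:
  fixes a :: nat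
  assumes "0 < a"
  shows "6 * (\<Sum>i=1..<a. int i ^ 2 + int i * (int a - int i) + (int a - int i) ^ 2)
      = 5 * int a ^ 3 - 6 * int a ^ 2 + int a"
proof -
  obtain m where a: "a = Suc m" using assms by (cases a) auto
  define M where "M = int m + 1"
  have M: "int a = M" and m: "int m = M - 1" by (simp_all add: a M_def)
  have "(\<Sum>i=1..<a. int i ^ 2 + int i * (int a - int i) + (int a - int i) ^ 2)
      = (\<Sum>i=1..<Suc m. int i ^ 2 - M * int i + M ^ 2)"
    unfolding M unfolding a by (intro sum.cong refl) Groebner_Basis.algebra
  also have "\<dots> = (\<Sum>i=1..<Suc m. int i ^ 2) - M * (\<Sum>i=1..<Suc m. int i) + (M - 1) * M ^ 2"
    by (simp add: m sum.distrib sum_subtractf mult.assoc del: sum.op_ivl_Suc flip: sum_distrib_left)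
  finally have sum: "(\<Sum>i=1..<a. int i ^ 2 + int i * (int a - int i) + (int a - int i) ^ 2) =
      (\<Sum>i=1..<Suc m. int i ^ 2) - M * (\<Sum>i=1..<Suc m. int i) + (M - 1) * M ^ 2" .
  \<comment> \<open>Each power sum is grouped with the denominator it has in
    \<open>power_sums\<close>.\<close>
  have "6 * (\<Sum>i=1..<a. int i ^ 2 + int i * (int a - int i) + (int a - int i) ^ 2) =
      (6 * (\<Sum>i=1..<Suc m. int i ^ 2)) - 3 * M * (2 * (\<Sum>i=1..<Suc m. int i)) + 6 * M ^ 2 * (M - 1)"
    unfolding sum by Groebner_Basis.algebra
  also have "\<dots> = 5 * M ^ 3 - 6 * M ^ 2 + M"
    unfolding power_sums[of m, folded M_def] by Groebner_Basis.algebra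
  finally show ?thesis
    by (simp only: M)
qed

lemma sum_norm_form_square:
  fixes a :: nat
  assumes "0 < a"
  shows "30 * (\<Sum>i=1..<a. (int i ^ 2 + int i * (int a - int i) + (int a - int i) ^ 2) ^ 2)
      = 21 * int a ^ 5 - 30 * int a ^ 4 + 10 * int a ^ 3 - int a"
proof -
  obtain m where a: "a = Suc m" using assms by (cases a) auto
  define M where "M = int m + 1"
  have M: "int a = M" and m: "int m = M - 1" by (simp_all add: a M_def)
  have "(\<Sum>i=1..<a. (int i ^ 2 + int i * (int a - int i) + (int a - int i) ^ 2) ^ 2)
      = (\<Sum>i=1..<Suc m. int i ^ 4 - 2 * M * int i ^ 3 + 3 * M ^ 2 * int i ^ 2 - 2 * M ^ 3 * int i
      + M ^ 4)"
    unfolding M unfolding a by (intro sum.cong refl) Groebner_Basis.algebra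
  also have "\<dots> = (\<Sum>i=1..<Suc m. int i ^ 4) - 2 * M * (\<Sum>i=1..<Suc m. int i ^ 3)
      + 3 * M ^ 2 * (\<Sum>i=1..<Suc m. int i ^ 2) - 2 * M ^ 3 * (\<Sum>i=1..<Suc m. int i) + (M - 1) * M ^ 4"
    by (simp add: m sum.distrib sum_subtractf mult.assoc del: sum.op_ivl_Suc flip: sum_distrib_left)
  finally have sum: "(\<Sum>i=1..<a. (int i ^ 2 + int i * (int a - int i) + (int a - int i) ^ 2) ^ 2) =
      (\<Sum>i=1..<Suc m. int i ^ 4) - 2 * M * (\<Sum>i=1..<Suc m. int i ^ 3) + 3 * M ^ 2 * (\<Sum>i=1..<Suc m.
          int i ^ 2) - 2 * M ^ 3 * (\<Sum>i=1..<Suc m. int i) + (M - 1) * M ^ 4" .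
  have "30 * (\<Sum>i=1..<a. (int i ^ 2 + int i * (int a - int i) + (int a - int i) ^ 2) ^ 2) =
      (30 * (\<Sum>i=1..<Suc m. int i ^ 4)) - 15 * M * (4 * (\<Sum>i=1..<Suc m. int i ^ 3))
          + 15 * M ^ 2 * (6 * (\<Sum>i=1..<Suc m. int i ^ 2)) - 30 * M ^ 3 * (2 * (\<Sum>i=1..<Suc m. int
          i)) + 30 * M ^ 4 * (M - 1)"
    unfolding sum by Groebner_Basis.algebra
  also have "\<dots> = 21 * M ^ 5 - 30 * M ^ 4 + 10 * M ^ 3 - M"
    unfolding power_sums[of m, folded M_def] by Groebner_Basis.algebra
  finally show ?thesis
    by (simp only: M)
qed

lemma sum_norm_form_cube:
  fixes a :: nat
  assumes "0 < a"
  shows "420 * (\<Sum>i=1..<a. (int i ^ 2 + int i * (int a - int i) + (int a - int i) ^ 2) ^ 3)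
      = 249 * int a ^ 7 - 420 * int a ^ 6 + 210 * int a ^ 5 - 49 * int a ^ 3 + 10 * int a"
proof -
  obtain m where a: "a = Suc m" using assms by (cases a) auto
  define M where "M = int m + 1"
  have M: "int a = M" and m: "int m = M - 1" by (simp_all add: a M_def)
  have "(\<Sum>i=1..<a. (int i ^ 2 + int i * (int a - int i) + (int a - int i) ^ 2) ^ 3)
      = (\<Sum>i=1..<Suc m. int i ^ 6 - 3 * M * int i ^ 5 + 6 * M ^ 2 * int i ^ 4 - 7 * M ^ 3 * int i
      ^ 3 + 6 * M ^ 4 * int i ^ 2 - 3 * M ^ 5 * int i + M ^ 6)"
    unfolding M unfolding a by (intro sum.cong refl) Groebner_Basis.algebra
  also have "\<dots> = (\<Sum>i=1..<Suc m. int i ^ 6) - 3 * M * (\<Sum>i=1..<Suc m. int i ^ 5)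
      + 6 * M ^ 2 * (\<Sum>i=1..<Suc m. int i ^ 4) - 7 * M ^ 3 * (\<Sum>i=1..<Suc m. int i ^ 3)
      + 6 * M ^ 4 * (\<Sum>i=1..<Suc m. int i ^ 2) - 3 * M ^ 5 * (\<Sum>i=1..<Suc m. int i) + (M - 1) * M ^ 6"
    by (simp add: m sum.distrib sum_subtractf mult.assoc del: sum.op_ivl_Suc flip: sum_distrib_left)
  finally have sum: "(\<Sum>i=1..<a. (int i ^ 2 + int i * (int a - int i) + (int a - int i) ^ 2) ^ 3) =
      (\<Sum>i=1..<Suc m. int i ^ 6) - 3 * M * (\<Sum>i=1..<Suc m. int i ^ 5) + 6 * M ^ 2 * (\<Sum>i=1..<Suc m.
          int i ^ 4) - 7 * M ^ 3 * (\<Sum>i=1..<Suc m. int i ^ 3) + 6 * M ^ 4 * (\<Sum>i=1..<Suc m. int i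
          ^ 2) - 3 * M ^ 5 * (\<Sum>i=1..<Suc m. int i) + (M - 1) * M ^ 6" .
  have "420 * (\<Sum>i=1..<a. (int i ^ 2 + int i * (int a - int i) + (int a - int i) ^ 2) ^ 3) =
      10 * (42 * (\<Sum>i=1..<Suc m. int i ^ 6)) - 105 * M * (12 * (\<Sum>i=1..<Suc m. int i ^ 5))
          + 84 * M ^ 2 * (30 * (\<Sum>i=1..<Suc m. int i ^ 4)) - 735 * M ^ 3 * (4 * (\<Sum>i=1..<Suc m.
          int i ^ 3)) + 420 * M ^ 4 * (6 * (\<Sum>i=1..<Suc m. int i ^ 2)) - 630 * M ^ 5 * (2 *
          (\<Sum>i=1..<Suc m. int i)) + 420 * M ^ 6 * (M - 1)"
    unfolding sum by Groebner_Basis.algebra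
  also have "\<dots> = 249 * M ^ 7 - 420 * M ^ 6 + 210 * M ^ 5 - 49 * M ^ 3 + 10 * M"
    unfolding power_sums[of m, folded M_def] by Groebner_Basis.algebra
  finally show ?thesis
    by (simp only: M)
qed

lemma sum_disc_form:
  fixes a :: nat
  assumes "0 < a"
  shows "30 * (\<Sum>i=1..<a. (int i * (int a - int i) * (int i + (int a - int i))) ^ 2) = int a ^ 7
      - int a ^ 3"
proof -
  obtain m where a: "a = Suc m" using assms by (cases a) auto
  define M where "M = int m + 1"
  have M: "int a = M" and m: "int m = M - 1" by (simp_all add: a M_def)
  have "(\<Sum>i=1..<a. (int i * (int a - int i) * (int i + (int a - int i))) ^ 2)
      = (\<Sum>i=1..<Suc m. M ^ 2 * int i ^ 4 - 2 * M ^ 3 * int i ^ 3 + M ^ 4 * int i ^ 2)"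
    unfolding M unfolding a by (intro sum.cong refl) Groebner_Basis.algebra
  also have "\<dots> = M ^ 2 * (\<Sum>i=1..<Suc m. int i ^ 4) - 2 * M ^ 3 * (\<Sum>i=1..<Suc m. int i ^ 3)
      + M ^ 4 * (\<Sum>i=1..<Suc m. int i ^ 2)"
    by (simp add: m sum.distrib sum_subtractf mult.assoc del: sum.op_ivl_Suc flip: sum_distrib_left)
  finally have sum: "(\<Sum>i=1..<a. (int i * (int a - int i) * (int i + (int a - int i))) ^ 2) =
      M ^ 2 * (\<Sum>i=1..<Suc m. int i ^ 4) - 2 * M ^ 3 * (\<Sum>i=1..<Suc m. int i ^ 3)
          + M ^ 4 * (\<Sum>i=1..<Suc m. int i ^ 2)" .
  have "30 * (\<Sum>i=1..<a. (int i * (int a - int i) * (int i + (int a - int i))) ^ 2) =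
      M ^ 2 * (30 * (\<Sum>i=1..<Suc m. int i ^ 4)) - 15 * M ^ 3 * (4 * (\<Sum>i=1..<Suc m. int i ^ 3))
          + 5 * M ^ 4 * (6 * (\<Sum>i=1..<Suc m. int i ^ 2))"
    unfolding sum by Groebner_Basis.algebra
  also have "\<dots> = M ^ 7 - M ^ 3"
    unfolding power_sums[of m, folded M_def] by Groebner_Basis.algebra
  finally show ?thesis
    by (simp only: M)
qed

text \<open>For \<open>g = a^2 + a b + b^2\<close> the difference \<open>g a (b - a) - g a b\<close>
  is \<open>- 2 a b\<close>. The \<open>sigma_fps 2\<close> terms from the cofactor sum and the
  diagonal cancel.\<close>

lemma sigma_1_1:
  "12 * sigma_fps 1 ^ 2 = 5 * sigma_fps 3 + sigma_fps 1 - 6 * fps_theta (sigma_fps 1)"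
proof (rule fps_ext)
  fix n
  have "6 * (\<Sum>(a, x, b, y)\<in>reps n. - 2 * (int a ^ 1 * int b ^ 1)) =
      6 * (\<Sum>(a, x)\<in>divpairs n. (int x - 1) * (int a ^ 2 + int a * 0 + 0 ^ 2)) -
      (\<Sum>(a, x)\<in>divpairs n. 5 * int a ^ 3 - 6 * int a ^ 2 + int a)"
    by (rule sum_reps_shear_poly[where g = "\<lambda>a b. a ^ 2 + a * b + b ^ 2" and
          h = "\<lambda>a b. - 2 * (a ^ 1 * b ^ 1)" and q = "\<lambda>a. 5 * a ^ 3 - 6 * a ^ 2 + a"])
       (erule sum_norm_form | Groebner_Basis.algebra)+
  moreover have "(\<Sum>(a, x, b, y)\<in>reps n. - 2 * (int a ^ 1 * int b ^ 1)) =
      - 2 * fps_nth (sigma_fps 1 * sigma_fps 1) n"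
    by (simp add: case_prod_unfold sum.distrib sum_subtractf sum_negf sum_distrib_left
          flip: sum_reps_eq_mult_nth)
  moreover have "(\<Sum>(a, x)\<in>divpairs n. (int x - 1) * (int a ^ 2 + int a * 0 + 0 ^ 2)) =
      int n * fps_nth (sigma_fps 1) n - fps_nth (sigma_fps 2) n"
    using sum_divpairs_cofactor[of 1 n] by (simp add: numeral_eq_Suc mult_ac)
  moreover have "(\<Sum>(a, x)\<in>divpairs n. 5 * int a ^ 3 - 6 * int a ^ 2 + int a) =
      5 * fps_nth (sigma_fps 3) n - 6 * fps_nth (sigma_fps 2) n + fps_nth (sigma_fps 1) n"
    by (simp add: sigma_fps_def case_prod_unfold sum.distrib sum_subtractf flip: sum_distrib_left)
  ultimately show "fps_nth (12 * sigma_fps 1 ^ 2) n =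
      fps_nth (5 * sigma_fps 3 + sigma_fps 1 - 6 * fps_theta (sigma_fps 1)) n"
    by (simp add: power2_eq_square)
qed

text \<open>The same with the square of the norm form; now \<open>sigma_fps 4\<close>
  cancels.\<close>

lemma sigma_1_3:
  "240 * (sigma_fps 1 * sigma_fps 3) = 21 * sigma_fps 5 + 10 * sigma_fps 3 - sigma_fps 1
      - 30 * fps_theta (sigma_fps 3)"
proof (rule fps_ext)
  fix n
  have "30 * (\<Sum>(a, x, b, y)\<in>reps n. - 4 * (int a ^ 1 * int b ^ 3) - 4 * (int a ^ 3 * int b ^ 1)) =
      30 * (\<Sum>(a, x)\<in>divpairs n. (int x - 1) * ((int a ^ 2 + int a * 0 + 0 ^ 2) ^ 2)) -
      (\<Sum>(a, x)\<in>divpairs n. 21 * int a ^ 5 - 30 * int a ^ 4 + 10 * int a ^ 3 - int a)"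
    by (rule sum_reps_shear_poly[where g = "\<lambda>a b. (a ^ 2 + a * b + b ^ 2) ^ 2" and
          h = "\<lambda>a b. - 4 * (a ^ 1 * b ^ 3) - 4 * (a ^ 3 * b ^ 1)" and q = "\<lambda>a. 21 * a ^ 5
              - 30 * a ^ 4 + 10 * a ^ 3 - a"])
       (erule sum_norm_form_square | Groebner_Basis.algebra)+
  moreover have "(\<Sum>(a, x, b, y)\<in>reps n. - 4 * (int a ^ 1 * int b ^ 3) - 4 * (int a ^ 3 * int b ^
      1)) =
      - 4 * fps_nth (sigma_fps 1 * sigma_fps 3) n - 4 * fps_nth (sigma_fps 3 * sigma_fps 1) n"
    by (simp add: case_prod_unfold sum.distrib sum_subtractf sum_negf sum_distrib_left
          flip: sum_reps_eq_mult_nth)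
  moreover have "(\<Sum>(a, x)\<in>divpairs n. (int x - 1) * ((int a ^ 2 + int a * 0 + 0 ^ 2) ^ 2)) =
      int n * fps_nth (sigma_fps 3) n - fps_nth (sigma_fps 4) n"
    using sum_divpairs_cofactor[of 3 n] by (simp add: numeral_eq_Suc mult_ac)
  moreover have "(\<Sum>(a, x)\<in>divpairs n. 21 * int a ^ 5 - 30 * int a ^ 4 + 10 * int a ^ 3 - int a) =
      21 * fps_nth (sigma_fps 5) n - 30 * fps_nth (sigma_fps 4) n + 10 * fps_nth (sigma_fps 3) n
          - fps_nth (sigma_fps 1) n"
    by (simp add: sigma_fps_def case_prod_unfold sum.distrib sum_subtractf flip: sum_distrib_left)
  moreover have "fps_nth (sigma_fps 3 * sigma_fps 1) n = fps_nth (sigma_fps 1 * sigma_fps 3) n"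
    by (simp only: mult.commute)
  ultimately show "fps_nth (240 * (sigma_fps 1 * sigma_fps 3)) n =
      fps_nth (21 * sigma_fps 5 + 10 * sigma_fps 3 - sigma_fps 1 - 30 * fps_theta (sigma_fps 3)) n"
    by simp
qed

text \<open>Equivalent to the Eisenstein identity \<open>E\<^sub>4\<^sup>2 = E\<^sub>8\<close>. The
  form vanishes at \<open>b = 0\<close>, hence no \<open>\<theta>\<close> term.\<close>

lemma sigma_3_3:
  "120 * sigma_fps 3 ^ 2 = sigma_fps 7 - sigma_fps 3"
proof (rule fps_ext)
  fix n
  have "30 * (\<Sum>(a, x, b, y)\<in>reps n. - 4 * (int a ^ 3 * int b ^ 3)) =
      30 * (\<Sum>(a, x)\<in>divpairs n. (int x - 1) * ((int a * 0 * (int a + 0)) ^ 2)) -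
      (\<Sum>(a, x)\<in>divpairs n. int a ^ 7 - int a ^ 3)"
    by (rule sum_reps_shear_poly[where g = "\<lambda>a b. (a * b * (a + b)) ^ 2" and
          h = "\<lambda>a b. - 4 * (a ^ 3 * b ^ 3)" and q = "\<lambda>a. a ^ 7 - a ^ 3"])
       (erule sum_disc_form | Groebner_Basis.algebra)+
  moreover have "(\<Sum>(a, x, b, y)\<in>reps n. - 4 * (int a ^ 3 * int b ^ 3)) =
      - 4 * fps_nth (sigma_fps 3 * sigma_fps 3) n"
    by (simp add: case_prod_unfold sum.distrib sum_subtractf sum_negf sum_distrib_left
          flip: sum_reps_eq_mult_nth)
  moreover have "(\<Sum>(a, x)\<in>divpairs n. (int x - 1) * ((int a * 0 * (int a + 0)) ^ 2)) =
      0"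
    by (simp add: case_prod_unfold)
  moreover have "(\<Sum>(a, x)\<in>divpairs n. int a ^ 7 - int a ^ 3) =
      fps_nth (sigma_fps 7) n - fps_nth (sigma_fps 3) n"
    by (simp add: sigma_fps_def case_prod_unfold sum.distrib sum_subtractf flip: sum_distrib_left)
  ultimately show "fps_nth (120 * sigma_fps 3 ^ 2) n =
      fps_nth (sigma_fps 7 - sigma_fps 3) n"
    by (simp add: power2_eq_square)
qed

text \<open>The cube of the norm form also yields \<open>a^3 b^3\<close>, which
  \<open>sigma_3_3\<close> eliminates.\<close>

lemma sigma_1_5:
  "504 * (sigma_fps 1 * sigma_fps 5) = 20 * sigma_fps 7 + 21 * sigma_fps 5 + sigma_fps 1
      - 42 * fps_theta (sigma_fps 5)"
proof (rule fps_ext)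
  fix n
  have "420 * (\<Sum>(a, x, b, y)\<in>reps n. - 6 * (int a ^ 1 * int b ^ 5) - 6 * (int a ^ 5 * int b ^ 1)
      - 14 * (int a ^ 3 * int b ^ 3)) =
      420 * (\<Sum>(a, x)\<in>divpairs n. (int x - 1) * ((int a ^ 2 + int a * 0 + 0 ^ 2) ^ 3)) -
      (\<Sum>(a, x)\<in>divpairs n. 249 * int a ^ 7 - 420 * int a ^ 6 + 210 * int a ^ 5 - 49 * int a ^ 3
          + 10 * int a)"
    by (rule sum_reps_shear_poly[where g = "\<lambda>a b. (a ^ 2 + a * b + b ^ 2) ^ 3" and
          h = "\<lambda>a b. - 6 * (a ^ 1 * b ^ 5) - 6 * (a ^ 5 * b ^ 1) - 14 * (a ^ 3 * b ^ 3)" and q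
              = "\<lambda>a. 249 * a ^ 7 - 420 * a ^ 6 + 210 * a ^ 5 - 49 * a ^ 3 + 10 * a"])
       (erule sum_norm_form_cube | Groebner_Basis.algebra)+
  moreover have "(\<Sum>(a, x, b, y)\<in>reps n. - 6 * (int a ^ 1 * int b ^ 5) - 6 * (int a ^ 5 * int b ^
      1) - 14 * (int a ^ 3 * int b ^ 3)) =
      - 6 * fps_nth (sigma_fps 1 * sigma_fps 5) n - 6 * fps_nth (sigma_fps 5 * sigma_fps 1) n
          - 14 * fps_nth (sigma_fps 3 * sigma_fps 3) n"
    by (simp add: case_prod_unfold sum.distrib sum_subtractf sum_negf sum_distrib_left
          flip: sum_reps_eq_mult_nth)
  moreover have "(\<Sum>(a, x)\<in>divpairs n. (int x - 1) * ((int a ^ 2 + int a * 0 + 0 ^ 2) ^ 3)) =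
      int n * fps_nth (sigma_fps 5) n - fps_nth (sigma_fps 6) n"
    using sum_divpairs_cofactor[of 5 n] by (simp add: numeral_eq_Suc mult_ac)
  moreover have "(\<Sum>(a, x)\<in>divpairs n. 249 * int a ^ 7 - 420 * int a ^ 6 + 210 * int a ^ 5
      - 49 * int a ^ 3 + 10 * int a) =
      249 * fps_nth (sigma_fps 7) n - 420 * fps_nth (sigma_fps 6) n
          + 210 * fps_nth (sigma_fps 5) n - 49 * fps_nth (sigma_fps 3) n
          + 10 * fps_nth (sigma_fps 1) n"
    by (simp add: sigma_fps_def case_prod_unfold sum.distrib sum_subtractf flip: sum_distrib_left)
  moreover have "120 * fps_nth (sigma_fps 3 * sigma_fps 3) n = fps_nth (sigma_fps 7) n
      - fps_nth (sigma_fps 3) n"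
    using arg_cong[OF sigma_3_3, of "\<lambda>f. fps_nth f n"] by (simp add: power2_eq_square)
  moreover have "fps_nth (sigma_fps 5 * sigma_fps 1) n = fps_nth (sigma_fps 1 * sigma_fps 5) n"
    by (simp only: mult.commute)
  ultimately show "fps_nth (504 * (sigma_fps 1 * sigma_fps 5)) n =
      fps_nth (20 * sigma_fps 7 + 21 * sigma_fps 5 + sigma_fps 1 - 42 * fps_theta (sigma_fps 5)) n"
    by simp
qed

section \<open>Ramanujan's differential equations\<close>

definition eisP :: "int fps" where "eisP = 1 - 24 * sigma_fps 1"

definition eisQ :: "int fps" where "eisQ = 1 + 240 * sigma_fps 3"

definition eisR :: "int fps" where "eisR = 1 - 504 * sigma_fps 5"

lemma fps_theta_1 [simp]: "fps_theta 1 = 0"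
  by (simp add: fps_theta_def)

lemma fps_theta_add: "fps_theta (f + g) = fps_theta f + fps_theta g"
  by (simp add: fps_theta_def algebra_simps)

lemma fps_theta_diff: "fps_theta (f - g) = fps_theta f - fps_theta g"
  by (simp add: fps_theta_def algebra_simps)

lemma fps_theta_mult: "fps_theta (f * g) = fps_theta f * g + f * fps_theta g"
  by (simp add: fps_theta_def algebra_simps)

lemma fps_theta_power: "fps_theta (f ^ n) = of_nat n * f ^ (n - 1) * fps_theta f"
  by (induction n) (simp_all add: fps_theta_mult algebra_simps power_eq_if)

lemma fps_theta_numeral_mult: "fps_theta (numeral k * f) = numeral k * fps_theta f"
  by (rule fps_ext) simp

lemma ramanujan_theta_P: "12 * fps_theta eisP = eisP ^ 2 - eisQ"
  using sigma_1_1 unfolding eisP_def eisQ_def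
  by (simp add: fps_theta_diff fps_theta_numeral_mult) Groebner_Basis.algebra

lemma ramanujan_theta_Q: "3 * fps_theta eisQ = eisP * eisQ - eisR"
  using sigma_1_3 unfolding eisP_def eisQ_def eisR_def
  by (simp add: fps_theta_add fps_theta_numeral_mult) Groebner_Basis.algebra

text \<open>The \<open>sigma_fps 7\<close> in \<open>sigma_1_5\<close> is absorbed into
  \<open>eisQ ^ 2\<close> by \<open>sigma_3_3\<close>.\<close>

lemma ramanujan_theta_R: "2 * fps_theta eisR = eisP * eisR - eisQ ^ 2"
  using sigma_1_5 sigma_3_3 unfolding eisP_def eisQ_def eisR_def
  by (simp add: fps_theta_diff fps_theta_numeral_mult) Groebner_Basis.algebra

lemma fps_theta_numeral [simp]: "fps_theta (numeral k) = 0"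
  by (simp add: fps_theta_def)

lemma fps_theta_X [simp]: "fps_theta fps_X = fps_X"
  by (simp add: fps_theta_def)

text \<open>Logarithmic differentiation of the product gives a Lambert series, whose coefficients
  are divisor sums.\<close>

lemma fps_theta_euler: "fps_theta euler_fps = - sigma_fps 1 * euler_fps"
proof (rule fps_eq_trunc_eqI)
  fix N
  \<comment> \<open>The expansion of \<open>k q^k / (1 - q^k)\<close>.\<close>
  define L where "L = (\<lambda>k. Abs_fps (\<lambda>n. if 0 < n \<and> k dvd n then int k else 0))"
  have L: "(1 - fps_X ^ k) * L k = of_nat k * fps_X ^ k" if "0 < k" for k
  proof (rule fps_ext)
    fix n
    show "fps_nth ((1 - fps_X ^ k) * L k) n = fps_nth (of_nat k * fps_X ^ k) n"
      using that
      by (auto simp: L_def left_diff_distrib fps_X_power_mult_nth fps_X_power_mult_right_nth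
          not_less dvd_minus_self dest: dvd_imp_le)
  qed
  have qpoch: "fps_theta (qpoch M) = - (\<Sum>k=1..M. L k) * qpoch M" for M
  proof (induction M)
    case (Suc M)
    have "fps_theta (1 - fps_X ^ Suc M) = - of_nat (Suc M) * fps_X ^ Suc M"
      unfolding fps_theta_diff fps_theta_power fps_theta_X by (simp add: algebra_simps)
    also have "\<dots> = - ((1 - fps_X ^ Suc M) * L (Suc M))"
      by (simp only: L[OF zero_less_Suc] mult_minus_left)
    finally have theta: "fps_theta (1 - fps_X ^ Suc M) = - ((1 - fps_X ^ Suc M) * L (Suc M))" .
    show ?case
      unfolding qpoch_Suc fps_theta_mult Suc.IH theta by (simp add: algebra_simps)
  qed simp
  have "trunc_eq (Suc N) (\<Sum>k=1..N. L k) (sigma_fps 1)"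
    unfolding trunc_eq_def
  proof (intro allI impI)
    fix n assume n: "n < Suc N"
    have "a \<le> a * b" if "0 < b" for a b :: nat
      using that by simp
    then have le: "a \<le> N" if "a * b < Suc N" "0 < b" for a b :: nat
      using that by (meson le_trans less_Suc_eq_le)
    have "(\<Sum>(a, x)\<in>divpairs n. int a) = (\<Sum>k | k \<in> {1..N} \<and> 0 < n \<and> k dvd n. int k)"
      by (rule sum.reindex_bij_witness[where i = "\<lambda>k. (k, n div k)" and j = fst])
         (use n in \<open>auto simp: divpairs_def div_greater_zero_iff intro: Suc_leI le dest:
             dvd_imp_le\<close>)
    then show "fps_nth (\<Sum>k=1..N. L k) n = fps_nth (sigma_fps 1) n"
      by (simp add: sigma_fps_def L_def fps_sum_nth sum.If_cases Int_def)
  qed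
  then have "trunc_eq (Suc N) (- (\<Sum>k=1..N. L k) * qpoch N) (- sigma_fps 1 * euler_fps)"
    by (intro trunc_eq_mult trunc_eq_sym[OF trunc_eq_euler]) (simp add: trunc_eq_def)
  moreover have "trunc_eq (Suc N) (fps_theta euler_fps) (fps_theta (qpoch N))"
    using trunc_eq_euler[of N] by (simp add: trunc_eq_def)
  ultimately have "trunc_eq (Suc N) (fps_theta euler_fps) (- sigma_fps 1 * euler_fps)"
    unfolding qpoch by (rule trunc_eq_trans[rotated])
  then show "trunc_eq N (fps_theta euler_fps) (- sigma_fps 1 * euler_fps)"
    by (rule trunc_eq_mono) simp
qed

definition delta_fps :: "int fps" where
  "delta_fps = fps_X * euler_fps ^ 24"

text \<open>In the logarithmic derivative \<open>q\<close> contributes \<open>1\<close> and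
  \<open>E^24\<close> contributes \<open>-24 sigma_fps 1\<close>.\<close>

lemma fps_theta_delta: "fps_theta delta_fps = eisP * delta_fps"
  unfolding delta_fps_def fps_theta_mult fps_theta_power fps_theta_euler eisP_def
  by (simp add: power_eq_if[of _ 24]) (simp add: algebra_simps)

text \<open>Comparing coefficients expresses \<open>(n - 1) f_n\<close> through earlier ones. The
  factor vanishes at \<open>n = 1\<close>, where the initial value decides.\<close>

lemma fps_theta_eq_mult_unique:
  assumes theta: "fps_theta f = g * f" and g: "fps_nth g 0 = 1"
    and f: "fps_nth f 0 = 0" "fps_nth f 1 = 0"
  shows "f = 0"
proof (rule fps_ext)
  fix n
  show "fps_nth f n = fps_nth 0 n"
  proof (induction n rule: less_induct)
    case (less n)
    have "int n * fps_nth f n = (\<Sum>i=0..n. fps_nth g i * fps_nth f (n - i))"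
      using arg_cong[OF theta, of "\<lambda>h. fps_nth h n"] by (simp add: fps_mult_nth)
    also have "\<dots> = (\<Sum>i\<in>{0}. fps_nth g i * fps_nth f (n - i))"
      by (rule sum.mono_neutral_right) (use less in auto)
    also have "\<dots> = fps_nth f n"
      using g by simp
    finally have "(int n - 1) * fps_nth f n = 0"
      by (simp add: algebra_simps)
    then show ?case
      using f by (cases "n = 1") auto
  qed
qed

lemma sigma_fps_nth_0 [simp]: "fps_nth (sigma_fps k) 0 = 0"
  by (simp add: sigma_fps_def)

lemma sigma_fps_nth_1 [simp]: "fps_nth (sigma_fps k) (Suc 0) = 1"
proof -
  have "divpairs 1 = {(1, 1)}"
    by (auto simp: divpairs_def)
  then show ?thesis
    by (simp add: sigma_fps_def)
qed

section \<open>Polynomial identities in an abstract solution of Ramanujan's system\<close>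

locale ramanujan_system =
  fixes P Q R :: "int fps"
  assumes theta_P: "12 * fps_theta P = P ^ 2 - Q"
    and theta_Q: "3 * fps_theta Q = P * Q - R"
    and theta_R: "2 * fps_theta R = P * R - Q ^ 2"
begin

lemma theta_discriminant: "fps_theta (Q ^ 3 - R ^ 2) = P * (Q ^ 3 - R ^ 2)"
proof -
  have "fps_theta (Q ^ 3 - R ^ 2) = Q ^ 2 * (3 * fps_theta Q) - R * (2 * fps_theta R)"
    by (simp add: fps_theta_diff fps_theta_power)
  also have "\<dots> = P * (Q ^ 3 - R ^ 2)"
    unfolding theta_Q theta_R by Groebner_Basis.algebra
  finally show ?thesis .
qed

text \<open>The factor \<open>24\<close> absorbs the denominators \<open>3\<close> and
  \<open>2\<close>, leaving \<open>8\<close> and \<open>12\<close>; successor exponents avoid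
  truncated subtraction.\<close>

lemma theta_Q_R_monomial:
  "24 * fps_theta (Q ^ Suc i * R ^ Suc j) =
     8 * of_nat (Suc i) * Q ^ i * R ^ Suc j * (P * Q - R)
     + 12 * of_nat (Suc j) * Q ^ Suc i * R ^ j * (P * R - Q ^ 2)"
  unfolding fps_theta_mult fps_theta_power theta_Q[symmetric] theta_R[symmetric]
  by (simp add: algebra_simps)

text \<open>For the Eisenstein series this is \<open>E\<^bsup>-3\<^esup> (3 (8 \<theta> + 1))\<^sup>k E\<^sup>3\<close>, where
  \<open>E = \<Prod> (1 - q\<^sup>k)\<close>; the factor \<open>3\<close> clears denominators.\<close>
primrec cov_deriv :: "nat \<Rightarrow> int fps" where
  "cov_deriv 0 = 1"
| "cov_deriv (Suc k) = 3 * P * cov_deriv k + 24 * fps_theta (cov_deriv k)"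

text \<open>The expansions are computed up to index \<open>8\<close>: \<open>(p - 1) div 2\<close>
  is \<open>5\<close> for \<open>p = 11\<close> and \<open>8\<close> for
  \<open>p = 17\<close>.\<close>

lemma cov_deriv_1:
  "cov_deriv 1 = 3 * P"
  by simp

lemma cov_deriv_2:
  "cov_deriv 2 = 15 * P ^ 2 - 6 * Q"
proof -
  have "cov_deriv 2 = 3 * P * cov_deriv 1 + 24 * fps_theta (cov_deriv 1)"
    by (simp add: eval_nat_numeral)
  also have "\<dots> = 15 * P ^ 2 - 6 * Q"
    unfolding cov_deriv_1 using theta_P theta_Q theta_R
    by (simp add: fps_theta_add fps_theta_diff fps_theta_mult fps_theta_power mult.assoc)
        Groebner_Basis.algebra
  finally show ?thesis .
qed

lemma cov_deriv_3:
  "cov_deriv 3 = 105 * P ^ 3 - 126 * P * Q + 48 * R"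
proof -
  have "cov_deriv 3 = 3 * P * cov_deriv 2 + 24 * fps_theta (cov_deriv 2)"
    by (simp add: eval_nat_numeral)
  also have "\<dots> = 105 * P ^ 3 - 126 * P * Q + 48 * R"
    unfolding cov_deriv_2 using theta_P theta_Q theta_R
    by (simp add: fps_theta_add fps_theta_diff fps_theta_mult fps_theta_power mult.assoc)
        Groebner_Basis.algebra
  finally show ?thesis .
qed

lemma cov_deriv_4:
  "cov_deriv 4 = 945 * P ^ 4 - 2268 * P ^ 2 * Q + 1728 * P * R - 324 * Q ^ 2"
proof -
  have "cov_deriv 4 = 3 * P * cov_deriv 3 + 24 * fps_theta (cov_deriv 3)"
    by (simp add: eval_nat_numeral)
  also have "\<dots> = 945 * P ^ 4 - 2268 * P ^ 2 * Q + 1728 * P * R - 324 * Q ^ 2"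
    unfolding cov_deriv_3 using theta_P theta_Q theta_R
    by (simp add: fps_theta_add fps_theta_diff fps_theta_mult fps_theta_power mult.assoc)
        Groebner_Basis.algebra
  finally show ?thesis .
qed

lemma cov_deriv_5:
  "cov_deriv 5 = 10395 * P ^ 5 - 41580 * P ^ 3 * Q + 47520 * P ^ 2 * R - 17820 * P * Q ^ 2
      + 1728 * Q * R"
proof -
  have "cov_deriv 5 = 3 * P * cov_deriv 4 + 24 * fps_theta (cov_deriv 4)"
    by (simp add: eval_nat_numeral)
  also have "\<dots> = 10395 * P ^ 5 - 41580 * P ^ 3 * Q + 47520 * P ^ 2 * R - 17820 * P * Q ^ 2
      + 1728 * Q * R"
    unfolding cov_deriv_4 using theta_P theta_Q theta_R
    by (simp add: fps_theta_add fps_theta_diff fps_theta_mult fps_theta_power mult.assoc)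
        Groebner_Basis.algebra
  finally show ?thesis .
qed

lemma cov_deriv_6:
  "cov_deriv 6 = 135135 * P ^ 6 - 810810 * P ^ 4 * Q + 1235520 * P ^ 3 * R - 694980 * P ^ 2 * Q
      ^ 2 + 134784 * P * Q * R + 14904 * Q ^ 3 - 13824 * R ^ 2"
proof -
  have "cov_deriv 6 = 3 * P * cov_deriv 5 + 24 * fps_theta (cov_deriv 5)"
    by (simp add: eval_nat_numeral)
  also have "\<dots> = 135135 * P ^ 6 - 810810 * P ^ 4 * Q + 1235520 * P ^ 3 * R - 694980 * P ^ 2 * Q
      ^ 2 + 134784 * P * Q * R + 14904 * Q ^ 3 - 13824 * R ^ 2"
    unfolding cov_deriv_5 using theta_P theta_Q theta_R
    by (simp add: fps_theta_add fps_theta_diff fps_theta_mult fps_theta_power mult.assoc)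
        Groebner_Basis.algebra
  finally show ?thesis .
qed

lemma cov_deriv_7:
  "cov_deriv 7 = 2027025 * P ^ 7 - 17027010 * P ^ 5 * Q + 32432400 * P ^ 4 * R
      - 24324300 * P ^ 3 * Q ^ 2 + 7076160 * P ^ 2 * Q * R + 1564920 * P * Q ^ 3
      - 1451520 * P * R ^ 2 - 295488 * Q ^ 2 * R"
proof -
  have "cov_deriv 7 = 3 * P * cov_deriv 6 + 24 * fps_theta (cov_deriv 6)"
    by (simp add: eval_nat_numeral)
  also have "\<dots> = 2027025 * P ^ 7 - 17027010 * P ^ 5 * Q + 32432400 * P ^ 4 * R
      - 24324300 * P ^ 3 * Q ^ 2 + 7076160 * P ^ 2 * Q * R + 1564920 * P * Q ^ 3
      - 1451520 * P * R ^ 2 - 295488 * Q ^ 2 * R"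
    unfolding cov_deriv_6 using theta_P theta_Q theta_R
    by (simp add: fps_theta_add fps_theta_diff fps_theta_mult fps_theta_power mult.assoc)
        Groebner_Basis.algebra
  finally show ?thesis .
qed

lemma cov_deriv_8:
  "cov_deriv 8 = 34459425 * P ^ 8 - 385945560 * P ^ 6 * Q + 882161280 * P ^ 5 * R
      - 827026200 * P ^ 4 * Q ^ 2 + 320785920 * P ^ 3 * Q * R + 106414560 * P ^ 2 * Q ^ 3
      - 98703360 * P ^ 2 * R ^ 2 - 40186368 * P * Q ^ 2 * R + 416016 * Q ^ 4 + 7630848 * Q * R ^ 2"
proof -
  have "cov_deriv 8 = 3 * P * cov_deriv 7 + 24 * fps_theta (cov_deriv 7)"
    by (simp add: eval_nat_numeral)
  also have "\<dots> = 34459425 * P ^ 8 - 385945560 * P ^ 6 * Q + 882161280 * P ^ 5 * R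
      - 827026200 * P ^ 4 * Q ^ 2 + 320785920 * P ^ 3 * Q * R + 106414560 * P ^ 2 * Q ^ 3
      - 98703360 * P ^ 2 * R ^ 2 - 40186368 * P * Q ^ 2 * R + 416016 * Q ^ 4 + 7630848 * Q * R ^ 2"
    unfolding cov_deriv_7 using theta_P theta_Q theta_R
    by (simp add: fps_theta_add fps_theta_diff fps_theta_mult fps_theta_power mult.assoc)
        Groebner_Basis.algebra
  finally show ?thesis .
qed

text \<open>The polynomials under \<open>\<theta>\<close> in the next two lemmas come from linear algebra modulo \<open>p\<close>. Their
  weights \<open>66\<close> and \<open>102\<close> are divisible by \<open>p\<close>, so that \<open>P\<close> drops out of the derivative modulo \<open>p\<close>.\<close>
lemma discriminant_4_exact_mod_11:
  "11 dvd 24 * fps_theta (5 * (Q ^ 3 * R ^ 9) + 9 * (Q ^ 6 * R ^ 7) + 5 * (Q ^ 9 * R ^ 5)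
      + 7 * (Q ^ 12 * R ^ 3)) - (Q ^ 3 - R ^ 2) ^ 4 * (Q * R) ^ 2"
proof -
  have m0: "24 * fps_theta (Q ^ 3 * R ^ 9) = 24 * Q ^ 2 * R ^ 9 * (P * Q - R) + 108 * Q ^ 3 * R
      ^ 8 * (P * R - Q ^ 2)"
    using theta_Q_R_monomial[of 2 8] by (simp del: power_Suc)
  have m1: "24 * fps_theta (Q ^ 6 * R ^ 7) = 48 * Q ^ 5 * R ^ 7 * (P * Q - R) + 84 * Q ^ 6 * R ^
      6 * (P * R - Q ^ 2)"
    using theta_Q_R_monomial[of 5 6] by (simp del: power_Suc)
  have m2: "24 * fps_theta (Q ^ 9 * R ^ 5) = 72 * Q ^ 8 * R ^ 5 * (P * Q - R) + 60 * Q ^ 9 * R ^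
      4 * (P * R - Q ^ 2)"
    using theta_Q_R_monomial[of 8 4] by (simp del: power_Suc)
  have m3: "24 * fps_theta (Q ^ 12 * R ^ 3) = 96 * Q ^ 11 * R ^ 3 * (P * Q - R)
      + 36 * Q ^ 12 * R ^ 2 * (P * R - Q ^ 2)"
    using theta_Q_R_monomial[of 11 2] by (simp del: power_Suc)
  have "24 * fps_theta (5 * (Q ^ 3 * R ^ 9) + 9 * (Q ^ 6 * R ^ 7) + 5 * (Q ^ 9 * R ^ 5)
      + 7 * (Q ^ 12 * R ^ 3)) =
      5 * (24 * fps_theta (Q ^ 3 * R ^ 9)) + 9 * (24 * fps_theta (Q ^ 6 * R ^ 7))
          + 5 * (24 * fps_theta (Q ^ 9 * R ^ 5)) + 7 * (24 * fps_theta (Q ^ 12 * R ^ 3))"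
    by (simp add: fps_theta_add fps_theta_numeral_mult)
  \<comment> \<open>With weights \<open>2, 4, 6\<close> for \<open>P, Q, R\<close>, the operator
    \<open>24 \<theta>\<close> multiplies weight \<open>66\<close> by \<open>132 P\<close> up to
    \<open>P\<close>-free terms, and \<open>11\<close> divides \<open>132\<close>. The square of
    \<open>Q R\<close> lifts weight \<open>48\<close> to the required \<open>66 + 2\<close>.\<close>
  also have "\<dots> = (Q ^ 3 - R ^ 2) ^ 4 * (Q * R) ^ 2 + 11 * (84 * P * Q ^ 12 * R ^ 3
      + 60 * P * Q ^ 9 * R ^ 5 + 108 * P * Q ^ 6 * R ^ 7 + 60 * P * Q ^ 3 * R ^ 9
      - 23 * Q ^ 14 * R ^ 2 - 88 * Q ^ 11 * R ^ 4 - 102 * Q ^ 8 * R ^ 6 - 88 * Q ^ 5 * R ^ 8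
      - 11 * Q ^ 2 * R ^ 10)"
    unfolding m0 m1 m2 m3 by Groebner_Basis.algebra
  finally show ?thesis
    by (simp only: add_diff_cancel_left' dvd_triv_left)
qed

lemma discriminant_2_exact_mod_17:
  "17 dvd 24 * fps_theta (2 * (Q ^ 6 * R ^ 13) + 4 * (Q ^ 9 * R ^ 11) + 16 * (Q ^ 12 * R ^ 9)
      + 7 * (Q ^ 15 * R ^ 7) + 14 * (Q ^ 18 * R ^ 5) + 4 * (Q ^ 21 * R ^ 3) + 12 * (Q ^ 24 * R ^
      1)) - (Q ^ 3 - R ^ 2) ^ 2 * (8 * Q ^ 4 - 7 * (Q * R ^ 2)) ^ 5"
proof -
  have m0: "24 * fps_theta (Q ^ 6 * R ^ 13) = 48 * Q ^ 5 * R ^ 13 * (P * Q - R)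
      + 156 * Q ^ 6 * R ^ 12 * (P * R - Q ^ 2)"
    using theta_Q_R_monomial[of 5 12] by (simp del: power_Suc)
  have m1: "24 * fps_theta (Q ^ 9 * R ^ 11) = 72 * Q ^ 8 * R ^ 11 * (P * Q - R)
      + 132 * Q ^ 9 * R ^ 10 * (P * R - Q ^ 2)"
    using theta_Q_R_monomial[of 8 10] by (simp del: power_Suc)
  have m2: "24 * fps_theta (Q ^ 12 * R ^ 9) = 96 * Q ^ 11 * R ^ 9 * (P * Q - R)
      + 108 * Q ^ 12 * R ^ 8 * (P * R - Q ^ 2)"
    using theta_Q_R_monomial[of 11 8] by (simp del: power_Suc)
  have m3: "24 * fps_theta (Q ^ 15 * R ^ 7) = 120 * Q ^ 14 * R ^ 7 * (P * Q - R)
      + 84 * Q ^ 15 * R ^ 6 * (P * R - Q ^ 2)"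
    using theta_Q_R_monomial[of 14 6] by (simp del: power_Suc)
  have m4: "24 * fps_theta (Q ^ 18 * R ^ 5) = 144 * Q ^ 17 * R ^ 5 * (P * Q - R)
      + 60 * Q ^ 18 * R ^ 4 * (P * R - Q ^ 2)"
    using theta_Q_R_monomial[of 17 4] by (simp del: power_Suc)
  have m5: "24 * fps_theta (Q ^ 21 * R ^ 3) = 168 * Q ^ 20 * R ^ 3 * (P * Q - R)
      + 36 * Q ^ 21 * R ^ 2 * (P * R - Q ^ 2)"
    using theta_Q_R_monomial[of 20 2] by (simp del: power_Suc)
  have m6: "24 * fps_theta (Q ^ 24 * R ^ 1) = 192 * Q ^ 23 * R ^ 1 * (P * Q - R)
      + 12 * Q ^ 24 * R ^ 0 * (P * R - Q ^ 2)"
    using theta_Q_R_monomial[of 23 0] by (simp del: power_Suc)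
  have "24 * fps_theta (2 * (Q ^ 6 * R ^ 13) + 4 * (Q ^ 9 * R ^ 11) + 16 * (Q ^ 12 * R ^ 9)
      + 7 * (Q ^ 15 * R ^ 7) + 14 * (Q ^ 18 * R ^ 5) + 4 * (Q ^ 21 * R ^ 3) + 12 * (Q ^ 24 * R ^
      1)) =
      2 * (24 * fps_theta (Q ^ 6 * R ^ 13)) + 4 * (24 * fps_theta (Q ^ 9 * R ^ 11))
          + 16 * (24 * fps_theta (Q ^ 12 * R ^ 9)) + 7 * (24 * fps_theta (Q ^ 15 * R ^ 7))
          + 14 * (24 * fps_theta (Q ^ 18 * R ^ 5)) + 4 * (24 * fps_theta (Q ^ 21 * R ^ 3))
          + 12 * (24 * fps_theta (Q ^ 24 * R ^ 1))"
    by (simp add: fps_theta_add fps_theta_numeral_mult)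
  \<comment> \<open>Here the \<open>P\<close> terms carry \<open>2 * 102 = 12 * 17\<close>, and the
    fifth power lifts weight \<open>24\<close> to \<open>24 + 5 * 16 = 102 + 2\<close>.\<close>
  also have "\<dots> = (Q ^ 3 - R ^ 2) ^ 2 * (8 * Q ^ 4 - 7 * (Q * R ^ 2)) ^ 5 + 17 * (144 * P * Q ^
      24 * R + 48 * P * Q ^ 21 * R ^ 3 + 168 * P * Q ^ 18 * R ^ 5 + 84 * P * Q ^ 15 * R ^ 7
      + 192 * P * Q ^ 12 * R ^ 9 + 48 * P * Q ^ 9 * R ^ 11 + 24 * P * Q ^ 6 * R ^ 13
      - 1936 * Q ^ 26 + 12144 * Q ^ 23 * R ^ 2 - 33640 * Q ^ 20 * R ^ 4 + 50708 * Q ^ 17 * R ^ 6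
      - 46384 * Q ^ 14 * R ^ 8 + 25079 * Q ^ 11 * R ^ 10 - 7662 * Q ^ 8 * R ^ 12
      + 983 * Q ^ 5 * R ^ 14)"
    unfolding m0 m1 m2 m3 m4 m5 m6 by Groebner_Basis.algebra
  finally show ?thesis
    by (simp only: add_diff_cancel_left' dvd_triv_left)
qed

end

interpretation eis: ramanujan_system eisP eisQ eisR
  by unfold_locales (fact ramanujan_theta_P ramanujan_theta_Q ramanujan_theta_R)+

text \<open>Both sides solve \<open>\<theta> f = P f\<close>, so two coefficients decide; the one at
  \<open>q\<close> is \<open>3 * 240 + 2 * 504 = 1728\<close>.\<close>

lemma eisenstein_discriminant: "eisQ ^ 3 - eisR ^ 2 = 1728 * delta_fps"
proof -
  define f where "f = eisQ ^ 3 - eisR ^ 2 - 1728 * delta_fps"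
  have "fps_theta f = eisP * f"
    unfolding f_def fps_theta_diff[of "eisQ ^ 3 - eisR ^ 2"] fps_theta_numeral_mult fps_theta_delta
      eis.theta_discriminant
    by (simp add: algebra_simps)
  moreover have "fps_nth f 0 = 0" "fps_nth f 1 = 0"
    by (simp_all add: f_def eisQ_def eisR_def delta_fps_def power2_eq_square power3_eq_cube
        fps_mult_nth_1 fps_nth_power_0)
  ultimately have "f = 0"
    by (intro fps_theta_eq_mult_unique[where g = eisP]) (simp_all add: eisP_def)
  then show ?thesis
    by (simp add: f_def)
qed

text \<open>Conjugating \<open>3 (8 \<theta> + 1)\<close> by \<open>E^3\<close> adds
  \<open>-72 sigma_fps 1\<close> to the constant \<open>3\<close>, and the sum is
  \<open>3 P\<close>.\<close>

lemma theta_euler_cube_mult: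
  "3 * (euler_fps ^ 3 * f) + 24 * fps_theta (euler_fps ^ 3 * f) =
     euler_fps ^ 3 * (3 * eisP * f + 24 * fps_theta f)"
  unfolding fps_theta_mult fps_theta_power fps_theta_euler eisP_def
  by (simp add: power_eq_if[of _ 3]) (simp add: algebra_simps)

lemma theta_euler_cube_mult_nth:
  assumes "\<And>n. fps_nth (euler_fps ^ 3 * f) n = (3 * int (8 * n + 1)) ^ k * fps_nth (euler_fps ^
      3) n"
    and "g = 3 * eisP * f + 24 * fps_theta f"
  shows "fps_nth (euler_fps ^ 3 * g) n = (3 * int (8 * n + 1)) ^ Suc k * fps_nth (euler_fps ^ 3) n"
proof -
  have "fps_nth (euler_fps ^ 3 * g) n = 3 * int (8 * n + 1) * fps_nth (euler_fps ^ 3 * f) n"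
    unfolding assms(2) theta_euler_cube_mult[symmetric] fps_add_nth fps_numeral_mult_nth
        fps_theta_nth
    by (simp add: algebra_simps)
  then show ?thesis
    by (simp only: assms(1) power_Suc mult.assoc)
qed

lemma euler_cube_cov_deriv_nth:
  "fps_nth (euler_fps ^ 3 * eis.cov_deriv k) n = (3 * int (8 * n
      + 1)) ^ k * fps_nth (euler_fps ^ 3) n"
proof (induction k arbitrary: n)
  case (Suc k)
  from theta_euler_cube_mult_nth[OF Suc] show ?case by simp
qed simp

section \<open>Reduction modulo a prime\<close>

lemma of_nat_dvd_fps_iff:
  "(of_nat p :: int fps) dvd f \<longleftrightarrow> (\<forall>n. int p dvd fps_nth f n)"
proof
  assume "\<forall>n. int p dvd fps_nth f n"
  then have "f = fps_const (int p) * Abs_fps (\<lambda>n. fps_nth f n div int p)"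
    by (intro fps_ext) simp
  also have "fps_const (int p) = of_nat p"
    by (simp add: fps_of_nat)
  finally show "of_nat p dvd f" by (rule dvdI)
qed (auto simp: dvd_def fps_of_nat[symmetric])

definition euler_inv :: "int fps" where
  "euler_inv = fps_right_inverse euler_fps 1"

lemma euler_inv: "euler_fps ^ n * euler_inv ^ n = 1"
proof -
  have "euler_fps * euler_inv = 1"
    unfolding euler_inv_def by (rule mult_fps_right_inverse_1) simp
  then show ?thesis
    by (simp flip: power_mult_distrib)
qed

text \<open>After multiplication by \<open>E^3\<close> the coefficients are explicit and
  \<open>euler_cube_nth_cong\<close> applies; the unit \<open>E^3\<close> is then removed.\<close>

lemma cov_deriv_cong:
  assumes "prime p" "odd p"
  shows "of_nat p dvd eis.cov_deriv ((p - 1) div 2) - 3 ^ ((p - 1) div 2)"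
proof -
  define k where "k = (p - 1) div 2"
  define u where "u = eis.cov_deriv k - 3 ^ k"
  have "int p dvd fps_nth (euler_fps ^ 3 * u) n" for n
  proof -
    have "fps_nth (3 ^ k * euler_fps ^ 3) n = 3 ^ k * fps_nth (euler_fps ^ 3) n"
      by (simp add: numeral_fps_const fps_const_power)
    then have "fps_nth (euler_fps ^ 3 * u) n =
        3 ^ k * (int (8 * n + 1) ^ k * fps_nth (euler_fps ^ 3) n - fps_nth (euler_fps ^ 3) n)"
      unfolding u_def right_diff_distrib fps_sub_nth euler_cube_cov_deriv_nth mult.commute[of _
          "3 ^ k"]
      by (simp only: power_mult_distrib mult.assoc)
    moreover have "int p dvd int (8 * n + 1) ^ k * fps_nth (euler_fps ^ 3) n
        - fps_nth (euler_fps ^ 3) n"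
      using euler_cube_nth_cong[OF assms, of n] unfolding k_def by (simp only: cong_iff_dvd_diff)
    ultimately show ?thesis
      by (simp only: dvd_mult)
  qed
  then have dvd: "of_nat p dvd euler_inv ^ 3 * (euler_fps ^ 3 * u)"
    by (intro dvd_mult[of _ "euler_fps ^ 3 * u"]) (simp add: of_nat_dvd_fps_iff)
  have "euler_inv ^ 3 * (euler_fps ^ 3 * u) = euler_fps ^ 3 * euler_inv ^ 3 * u"
    by (simp only: mult_ac)
  then have "euler_inv ^ 3 * (euler_fps ^ 3 * u) = u"
    by (simp only: euler_inv mult_1_left)
  with dvd show ?thesis
    by (simp only: u_def k_def)
qed

text \<open>In \<open>cov_deriv 5\<close> every coefficient of a term with \<open>P\<close> is
  divisible by \<open>11\<close>, while \<open>1728\<close> and \<open>3^5\<close> are both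
  \<open>1\<close> modulo \<open>11\<close>.\<close>

lemma eisenstein_relation_mod_11: "11 dvd eisQ * eisR - 1"
proof -
  define P Q R where PQR: "P = eisP" "Q = eisQ" "R = eisR"
  have "11 dvd eis.cov_deriv 5 - 3 ^ 5"
    using cov_deriv_cong[of 11] by simp
  moreover have "eis.cov_deriv 5 - 3 ^ 5 =
      (Q * R - 1) + 11 * (945 * P ^ 5 - 3780 * P ^ 3 * Q + 4320 * P ^ 2 * R - 1620 * P * Q ^ 2
          + 157 * Q * R - 22)"
    unfolding eis.cov_deriv_5 unfolding PQR[symmetric] by Groebner_Basis.algebra
  ultimately have "11 dvd Q * R - 1"
    by (metis dvd_add_left_iff dvd_triv_left)
  then show ?thesis
    by (simp only: PQR)
qed

text \<open>Again all terms with \<open>P\<close> in \<open>cov_deriv 8\<close> vanish modulo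
  \<open>17\<close>. The sign is reversed because \<open>3^8\<close> is \<open>-1\<close> modulo
  \<open>17\<close>.\<close>

lemma eisenstein_relation_mod_17: "17 dvd (8 * eisQ ^ 4 - 7 * (eisQ * eisR ^ 2)) - 1"
proof -
  define P Q R where PQR: "P = eisP" "Q = eisQ" "R = eisR"
  have "17 dvd eis.cov_deriv 8 - 3 ^ 8"
    using cov_deriv_cong[of 17] by simp
  moreover have "eis.cov_deriv 8 - 3 ^ 8 =
      17 * (2027025 * P ^ 8 - 22702680 * P ^ 6 * Q + 51891840 * P ^ 5 * R - 48648600 * P ^ 4 * Q
          ^ 2 + 18869760 * P ^ 3 * Q * R + 6259680 * P ^ 2 * Q ^ 3 - 5806080 * P ^ 2 * R ^ 2
          - 2363904 * P * Q ^ 2 * R + 24472 * Q ^ 4 + 448873 * Q * R ^ 2 - 386) - (8 * Q ^ 4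
          - 7 * (Q * R ^ 2) - 1)"
    unfolding eis.cov_deriv_8 unfolding PQR[symmetric] by Groebner_Basis.algebra
  ultimately have "17 dvd 8 * Q ^ 4 - 7 * (Q * R ^ 2) - 1"
    by (metis dvd_diff_right_iff dvd_triv_left)
  then show ?thesis
    by (simp only: PQR)
qed

lemma dvd_power_diff: "m dvd a - b \<Longrightarrow> m dvd a ^ n - b ^ n"
  for m a b :: "'a :: comm_ring_1"
proof (induction n)
  case (Suc n)
  have "a ^ Suc n - b ^ Suc n = a * (a ^ n - b ^ n) + (a - b) * b ^ n"
    by (simp add: algebra_simps)
  with Suc show ?case by simp
qed simp

text \<open>For prime \<open>p\<close>, modulo \<open>p\<close> this describes the image of
  \<open>\<theta>\<close>, and \<open>supported_on_multiples\<close> its kernel; the image is a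
  module over the kernel.\<close>

definition null_at_multiples :: "nat \<Rightarrow> int fps \<Rightarrow> bool" where
  "null_at_multiples p f \<longleftrightarrow> (\<forall>n. p dvd n \<longrightarrow> int p dvd fps_nth f n)"

definition supported_on_multiples :: "nat \<Rightarrow> int fps \<Rightarrow> bool" where
  "supported_on_multiples p f \<longleftrightarrow> (\<forall>n. \<not> p dvd n \<longrightarrow> int p dvd fps_nth f n)"

lemma supported_on_multiples_mult:
  assumes "supported_on_multiples p f" "supported_on_multiples p g"
  shows "supported_on_multiples p (f * g)"
  unfolding supported_on_multiples_def
proof (intro allI impI)
  fix n assume n: "\<not> p dvd n"
  show "int p dvd fps_nth (f * g) n"
    unfolding fps_mult_nth
  proof (rule dvd_sum)
    fix i assume "i \<in> {0..n}"
    then have "\<not> p dvd i \<or> \<not> p dvd n - i"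
      using n by (metis atLeastAtMost_iff dvd_add le_add_diff_inverse)
    with assms show "int p dvd fps_nth f i * fps_nth g (n - i)"
      by (auto simp: supported_on_multiples_def)
  qed
qed

lemma null_at_multiples_mult:
  assumes "null_at_multiples p f" "supported_on_multiples p g"
  shows "null_at_multiples p (f * g)"
  unfolding null_at_multiples_def
proof (intro allI impI)
  fix n assume n: "p dvd n"
  show "int p dvd fps_nth (f * g) n"
    unfolding fps_mult_nth
  proof (rule dvd_sum)
    fix i assume "i \<in> {0..n}"
    then have "p dvd i \<or> \<not> p dvd n - i"
      using n by (metis atLeastAtMost_iff dvd_diffD1)
    with assms show "int p dvd fps_nth f i * fps_nth g (n - i)"
      by (auto simp: supported_on_multiples_def null_at_multiples_def)
  qed
qed

text \<open>The derivative \<open>\<theta> (f^p) = p f^(p-1) \<theta> f\<close> vanishes modulo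
  \<open>p\<close>.\<close>

lemma supported_on_multiples_power:
  assumes "prime p"
  shows "supported_on_multiples p (f ^ p)"
  unfolding supported_on_multiples_def
proof (intro allI impI)
  fix n assume n: "\<not> p dvd n"
  have "int n * fps_nth (f ^ p) n = fps_nth (of_nat p * (f ^ (p - 1) * fps_theta f)) n"
    unfolding fps_theta_nth[symmetric] fps_theta_power by (simp only: mult.assoc)
  also have "\<dots> = int p * fps_nth (f ^ (p - 1) * fps_theta f) n"
    by (simp add: fps_of_nat[symmetric])
  finally have "int p dvd int n * fps_nth (f ^ p) n"
    by simp
  with n assms show "int p dvd fps_nth (f ^ p) n"
    by (simp add: prime_dvd_mult_iff)
qed

text \<open>A coefficient of \<open>\<theta> g\<close> at a multiple of \<open>p\<close> is
  divisible by \<open>p\<close>; the unit \<open>c\<close> leaves room for powers of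
  \<open>1728\<close>.\<close>

lemma null_at_multiples_exact:
  fixes p :: nat
  assumes "prime p" "of_nat p dvd 24 * fps_theta g - of_nat c * f" "\<not> p dvd c"
  shows "null_at_multiples p f"
  unfolding null_at_multiples_def
proof (intro allI impI)
  fix n assume n: "p dvd n"
  have "int p dvd fps_nth (24 * fps_theta g - of_nat c * f) n"
    using assms(2) by (simp only: of_nat_dvd_fps_iff)
  moreover have "fps_nth (24 * fps_theta g - of_nat c * f) n = int n * (24 * fps_nth g n)
      - int c * fps_nth f n"
    by (simp add: fps_of_nat[symmetric])
  moreover have "int p dvd int n * (24 * fps_nth g n)"
    using n by (intro dvd_mult2) simp
  ultimately have "int p dvd int c * fps_nth f n"
    by (metis dvd_diff_left_iff dvd_diff_right_iff)
  with assms show "int p dvd fps_nth f n"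
    by (simp add: prime_dvd_mult_iff)
qed

lemma prime_11: "prime (11 :: nat)" and prime_17: "prime (17 :: nat)"
  by simp_all

lemma dvd_diff_mult_cancel: "m dvd a - x * b \<Longrightarrow> m dvd b - 1 \<Longrightarrow> m dvd a - x"
  for m a b x :: "'a :: comm_ring_1"
proof -
  assume "m dvd a - x * b" "m dvd b - 1"
  then have "m dvd (a - x * b) + x * (b - 1)"
    by (intro dvd_add dvd_mult)
  then show ?thesis
    by (simp add: right_diff_distrib)
qed

lemma null_delta_4: "null_at_multiples 11 (delta_fps ^ 4)"
proof -
  have "11 dvd (eisQ * eisR) ^ 2 - 1"
    using dvd_power_diff[OF eisenstein_relation_mod_11, of 2] by simp
  \<comment> \<open>The auxiliary factor is \<open>1\<close> modulo \<open>11\<close>, so the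
    discriminant power alone is exact.\<close>
  from dvd_diff_mult_cancel[OF eis.discriminant_4_exact_mod_11 this]
  obtain g where "11 dvd 24 * fps_theta g - (eisQ ^ 3 - eisR ^ 2) ^ 4" ..
  then have "of_nat 11 dvd 24 * fps_theta g - of_nat (1728 ^ 4) * delta_fps ^ 4"
    unfolding eisenstein_discriminant by (simp add: power_mult_distrib)
  then show ?thesis
    by (rule null_at_multiples_exact[OF prime_11]) simp
qed

lemma null_delta_2: "null_at_multiples 17 (delta_fps ^ 2)"
proof -
  have "17 dvd (8 * eisQ ^ 4 - 7 * (eisQ * eisR ^ 2)) ^ 5 - 1"
    using dvd_power_diff[OF eisenstein_relation_mod_17, of 5] by simp
  from dvd_diff_mult_cancel[OF eis.discriminant_2_exact_mod_17 this]
  obtain g where "17 dvd 24 * fps_theta g - (eisQ ^ 3 - eisR ^ 2) ^ 2" ..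
  then have "of_nat 17 dvd 24 * fps_theta g - of_nat (1728 ^ 2) * delta_fps ^ 2"
    unfolding eisenstein_discriminant by (simp add: power_mult_distrib)
  then show ?thesis
    by (rule null_at_multiples_exact[OF prime_17]) simp
qed

section \<open>Assembling the congruences\<close>

lemma supported_theta_fps:
  assumes "prime p" "odd p" "p dvd Suc a"
  shows "supported_on_multiples p (theta_fps a)"
  unfolding supported_on_multiples_def by (intro allI impI theta_fps_nth_dvd assms)

text \<open>Multiplying by \<open>\<Delta>\<^sup>k\<close> completes \<open>E\<^sup>-\<^sup>3\<close> to a \<open>p\<close>-th power.\<close>
lemma fps_X_power_mult_MO_fps:
  assumes "24 * k + 3 = m * p"
  shows "fps_X ^ k * MO_fps a = delta_fps ^ k * (theta_fps a * (euler_inv ^ m) ^ p)"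
proof -
  have "delta_fps ^ k * (theta_fps a * (euler_inv ^ m) ^ p) =
      fps_X ^ k * MO_fps a * (euler_fps ^ (24 * k + 3) * euler_inv ^ (m * p))"
    by (simp add: delta_fps_def theta_fps_def power_mult_distrib power_add
        flip: power_mult)
  then show ?thesis
    unfolding assms by (simp add: euler_inv)
qed

text \<open>In the factorization of \<open>q^k M_a\<close> the power of \<Delta> is null at
  multiples of \<open>p\<close>, and the other two factors are supported there. The shift by
  \<open>k\<close> turns index \<open>n\<close> into a multiple of \<open>p\<close>.\<close>

lemma MO_cong_0:
  assumes p: "prime p" "odd p" "p dvd Suc a" and k: "24 * k + 3 = m * p"
    and null: "null_at_multiples p (delta_fps ^ k)" and n: "p dvd n + k"
  shows "[MO a n = 0] (mod int p)"
proof -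
  have "null_at_multiples p (fps_X ^ k * MO_fps a)"
    unfolding fps_X_power_mult_MO_fps[OF k]
    by (intro null_at_multiples_mult null supported_on_multiples_mult supported_theta_fps p
        supported_on_multiples_power)
  then have "int p dvd fps_nth (fps_X ^ k * MO_fps a) (n + k)"
    using n by (simp add: null_at_multiples_def)
  then show ?thesis
    by (simp add: fps_X_power_mult_nth MO_fps_def cong_0_iff)
qed

text \<open>For \<open>p = 3\<close> the inverse of \<open>E^3\<close> is itself a
  \<open>p\<close>-th power, so no power of \<Delta> is required and the whole series is supported
  on multiples of \<open>3\<close>.\<close>

lemma MO_mod_3:
  assumes "3 dvd Suc a" "\<not> 3 dvd n"
  shows "[MO a n = 0] (mod 3)"
proof -
  have "supported_on_multiples 3 (theta_fps a * euler_inv ^ 3)"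
    using assms(1) by (intro supported_on_multiples_mult supported_theta_fps
        supported_on_multiples_power) simp_all
  moreover have "theta_fps a * euler_inv ^ 3 = MO_fps a"
    using fps_X_power_mult_MO_fps[of 0 1 3 a] by simp
  ultimately show ?thesis
    using assms(2) by (simp add: supported_on_multiples_def MO_fps_def cong_0_iff)
qed

theorem theorem1p6:
  shows "(\<forall>n m :: nat.
            [MO (3 * m + 2) (3 * n + 1) = MO (3 * m + 2) (3 * n + 2)] (mod 3) \<and>
            [MO (3 * m + 2) (3 * n + 2) = 0] (mod 3)) \<and>
         (\<forall>n m :: nat. [MO (11 * m + 10) (11 * n + 7) = 0] (mod 11)) \<and>
         (\<forall>n m :: nat. [MO (17 * m + 16) (17 * n + 15) = 0] (mod 17))"
proof (intro conjI allI)
  fix n m :: nat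
  have "3 dvd Suc (3 * m + 2)" "\<not> 3 dvd 3 * n + 1" "\<not> 3 dvd 3 * n + 2"
    by presburger+
  then have "[MO (3 * m + 2) (3 * n + 1) = 0] (mod 3)" "[MO (3 * m + 2) (3 * n + 2) = 0] (mod 3)"
    by (simp_all only: MO_mod_3 not_False_eq_True)
  then show "[MO (3 * m + 2) (3 * n + 1) = MO (3 * m + 2) (3 * n + 2)] (mod 3)"
    "[MO (3 * m + 2) (3 * n + 2) = 0] (mod 3)"
    by (auto intro: cong_trans cong_sym)
next
  fix n m :: nat
  have "11 dvd Suc (11 * m + 10)" "11 dvd 11 * n + 7 + 4"
    by presburger+
  \<comment> \<open>The witnesses fit since \<open>24 * 4 + 3 = 9 * 11\<close>.\<close>
  from MO_cong_0[OF prime_11 _ this(1) _ null_delta_4 this(2), of 9]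
  show "[MO (11 * m + 10) (11 * n + 7) = 0] (mod 11)"
    by simp
next
  fix n m :: nat
  have "17 dvd Suc (17 * m + 16)" "17 dvd 17 * n + 15 + 2"
    by presburger+
  \<comment> \<open>Here \<open>24 * 2 + 3 = 3 * 17\<close>.\<close>
  from MO_cong_0[OF prime_17 _ this(1) _ null_delta_2 this(2), of 3]
  show "[MO (17 * m + 16) (17 * n + 15) = 0] (mod 17)"
    by simp
qed

end
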